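(* Both the Grigorchuk group and the Gupta--Sidki $3$-group obey the Grigorchuk--Nagnibeda alternative: if $G$ is either of these groups acting on its tree $X^*$, then for every finitely generated subgroup $H\le G$, either there is $y\in X^*$ such that $\psi_y(H)$ is finite, or there is a spanning leaf set $Y\subseteq X^*$ such that $\psi_y(\mathrm{st}_H(Y))$ is a finite index subgroup of $G$ for every $y\in Y$.
   Context: The Grigorchuk group acts on the binary tree $X^*$, $X=\{0,1\}$, and is generated by $a,b,c,d$ where $a(0w)=1w$, $a(1w)=0w$, and $b(0w)=0a(w)$, $b(1w)=1c(w)$, $c(0w)=0a(w)$, $c(1w)=1d(w)$, $d(0w)=0w$, $d(1w)=1b(w)$. The Gupta--Sidki $3$-group acts on the ternary tree $X^*$, $X=\{0,1,2\}$, and is generated by $a$ and $t$, where $a(iw)=(i+1\bmod 3)w$ and $t(0w)=0a(w)$, $t(1w)=1a^{-1}(w)$, $t(2w)=2t(w)$. Here $X^*$ is the free monoid on $X$ viewed as a rooted tree; for an automorphism $g$ and $u\in X^*$ the section $g_u$ is defined by $g(uw)=g(u)g_u(w)$; $\psi_u(g)=g_u$ and $\psi_u(S)=\{g_u:g\in S\}$. $\mathrm{st}_H(Y)$ is the set of elements of $H$ fixing every vertex of $Y$. A leaf set is a finite $Y\subseteq X^*$ no element of which is a prefix of another; it is spanning if there is $N$ such that every word of length $\ge N$ has a prefix in $Y$. *)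

theory Defs
  imports Main "HOL-Library.Sublist"
begin

text \<open>The tree X^* is the type of lists over the alphabet type 'x; automorphisms
are functions on words. The alphabet is the whole (finite) type 'x.\<close>

inductive_set gen_grp :: "('a \<Rightarrow> 'a) set \<Rightarrow> ('a \<Rightarrow> 'a) set" for S where
  gen_id: "id \<in> gen_grp S"
| gen_mul: "s \<in> S \<Longrightarrow> f \<in> gen_grp S \<Longrightarrow> s \<circ> f \<in> gen_grp S"
| gen_inv: "s \<in> S \<Longrightarrow> f \<in> gen_grp S \<Longrightarrow> inv s \<circ> f \<in> gen_grp S"

text \<open>Section g_u, defined by g(uw) = g(u) g_u(w).\<close>
definition sect :: "('x list \<Rightarrow> 'x list) \<Rightarrow> 'x list \<Rightarrow> ('x list \<Rightarrow> 'x list)" where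
  "sect g u = (\<lambda>w. drop (length u) (g (u @ w)))"

definition psi :: "'x list \<Rightarrow> ('x list \<Rightarrow> 'x list) set \<Rightarrow> ('x list \<Rightarrow> 'x list) set" where
  "psi u S = (\<lambda>g. sect g u) ` S"

definition stab :: "('x list \<Rightarrow> 'x list) set \<Rightarrow> 'x list set \<Rightarrow> ('x list \<Rightarrow> 'x list) set" where
  "stab H Y = {g \<in> H. \<forall>y\<in>Y. g y = y}"

definition leaf_set :: "'x list set \<Rightarrow> bool" where
  "leaf_set Y \<longleftrightarrow> finite Y \<and> (\<forall>u\<in>Y. \<forall>v\<in>Y. u \<noteq> v \<longrightarrow> \<not> prefix u v)"

definition spanning :: "'x list set \<Rightarrow> bool" where
  "spanning Y \<longleftrightarrow> (\<exists>N. \<forall>w :: 'x list. length w \<ge> N \<longrightarrow> (\<exists>y\<in>Y. prefix y w))"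

definition finite_index_subgroup :: "('a \<Rightarrow> 'a) set \<Rightarrow> ('a \<Rightarrow> 'a) set \<Rightarrow> bool" where
  "finite_index_subgroup K G \<longleftrightarrow>
     K \<subseteq> G \<and> id \<in> K \<and> (\<forall>f\<in>K. \<forall>g\<in>K. f \<circ> g \<in> K) \<and> (\<forall>f\<in>K. inv f \<in> K) \<and>
     finite {(\<lambda>k. g \<circ> k) ` K | g. g \<in> G}"

definition GN_alternative :: "('x list \<Rightarrow> 'x list) set \<Rightarrow> bool" where
  "GN_alternative G \<longleftrightarrow>
    (\<forall>S. finite S \<and> S \<subseteq> G \<longrightarrow>
       (let H = gen_grp S in
         (\<exists>y. finite (psi y H)) \<or>
         (\<exists>Y. leaf_set Y \<and> spanning Y \<and>
              (\<forall>y\<in>Y. finite_index_subgroup (psi y (stab H Y)) G))))"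

section \<open>The Grigorchuk group (X = {0,1}, 0 = False, 1 = True)\<close>

fun gr_a :: "bool list \<Rightarrow> bool list" where
  "gr_a [] = []"
| "gr_a (x # w) = (\<not> x) # w"

fun gr_b :: "bool list \<Rightarrow> bool list"
and gr_c :: "bool list \<Rightarrow> bool list"
and gr_d :: "bool list \<Rightarrow> bool list" where
  "gr_b [] = []"
| "gr_b (False # w) = False # gr_a w"
| "gr_b (True # w) = True # gr_c w"
| "gr_c [] = []"
| "gr_c (False # w) = False # gr_a w"
| "gr_c (True # w) = True # gr_d w"
| "gr_d [] = []"
| "gr_d (False # w) = False # w"
| "gr_d (True # w) = True # gr_b w"

definition grigorchuk_group :: "(bool list \<Rightarrow> bool list) set" where
  "grigorchuk_group = gen_grp {gr_a, gr_b, gr_c, gr_d}"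

datatype tri = X0 | X1 | X2

fun tri_succ :: "tri \<Rightarrow> tri" where
  "tri_succ X0 = X1" | "tri_succ X1 = X2" | "tri_succ X2 = X0"

fun tri_pred :: "tri \<Rightarrow> tri" where
  "tri_pred X0 = X2" | "tri_pred X1 = X0" | "tri_pred X2 = X1"

fun gs_a :: "tri list \<Rightarrow> tri list" where
  "gs_a [] = []"
| "gs_a (i # w) = tri_succ i # w"

fun gs_a_inv :: "tri list \<Rightarrow> tri list" where
  "gs_a_inv [] = []"
| "gs_a_inv (i # w) = tri_pred i # w"

fun gs_t :: "tri list \<Rightarrow> tri list" where
  "gs_t [] = []"
| "gs_t (X0 # w) = X0 # gs_a w"
| "gs_t (X1 # w) = X1 # gs_a_inv w"
| "gs_t (X2 # w) = X2 # gs_t w"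

definition gupta_sidki_group :: "(tri list \<Rightarrow> tri list) set" where
  "gupta_sidki_group = gen_grp {gs_a, gs_t}"

end

theory Submission
  imports Defs "HOL-Library.FuncSet"
begin

text \<open>For a vertex \<open>y\<close> let \<open>H\<^sub>y\<close> be the group of sections at \<open>y\<close> of the stabilizer of \<open>y\<close> in \<open>H\<close>
  (\<open>vsec H y\<close>). The elements of \<open>G\<close> are values of words, and the number of letters other than \<open>a\<close>
  is additive: summed over the sections of a word at one level it stays the same. So if
  \<open>H\<close> is generated by a finite set \<open>S\<close>, the total number of such letters in the sections of the
  elements of \<open>S\<close> at the vertices of an \<open>H\<close>-orbit does not increase when one descends the tree, and
  it is shared out when the orbit splits. An orbit that receives nothing has only sections in the
  finite group of powers of \<open>a\<close>. By induction on this number it remains to treat vertices \<open>y\<close> for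
  which \<open>H\<^sub>y\<close> is transitive on every level, and then some further \<open>H\<^sub>y\<^sub>z\<close> is all of \<open>G\<close>, even if \<open>H\<close>
  is not finitely generated.

  For the latter claim, take an element of some \<open>H\<^sub>y\<close> that is nontrivial modulo commutators and \<open>a\<close>,
  of minimal length among all such elements for all \<open>y\<close>: up to a power it is a conjugate of \<open>t\<close>
  (respectively of \<open>b\<close>, \<open>c\<close> or \<open>d\<close>). In the Gupta--Sidki group transitivity then gives conjugates of both \<open>a\<close> and
  \<open>t\<close>, and passing to sections shortens the element by which they fail to be simultaneously
  conjugate. In the Grigorchuk group one considers \<open>s\<close> in the Klein group \<open>{1, b, c, d}\<close> together with
  a word of odd \<open>a\<close>-length whose class in that group is independent of \<open>s\<close>: after at most three
  sections of squares along the vertices \<open>1\<close>, \<open>11\<close>, \<open>111\<close> such a word gets shorter, until it is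
  \<open>a\<close> times an element of the Klein group.\<close>

section \<open>Tree automorphisms and sections of groups\<close>

text \<open>As \<open>sect\<close> is given by \<open>drop\<close>, it makes sense for every
  function; the middle condition is what says that \<open>g\<close> respects prefixes.\<close>

definition taut :: "('x list \<Rightarrow> 'x list) \<Rightarrow> bool" where
  "taut g \<longleftrightarrow> bij g \<and> (\<forall>u w. g (u @ w) = g u @ sect g u w) \<and> (\<forall>u. length (g u) = length u)"

lemma taut_bij: "taut g \<Longrightarrow> bij g"
  and taut_append: "taut g \<Longrightarrow> g (u @ w) = g u @ sect g u w"
  and taut_length: "taut g \<Longrightarrow> length (g u) = length u"
  by (simp_all add: taut_def)

lemma taut_Nil: "taut g \<Longrightarrow> g [] = []"
  using taut_length[of g "[]"] by (simp only: list.size length_0_conv)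

lemma taut_inv_f [simp]: "taut g \<Longrightarrow> inv g (g u) = u"
  and taut_f_inv: "taut g \<Longrightarrow> g (inv g u) = u"
  by (simp_all add: taut_bij bij_is_inj bij_is_surj surj_f_inv_f)

lemma taut_inv_comp [simp]: "taut g \<Longrightarrow> inv g \<circ> g = id"
  and taut_comp_inv [simp]: "taut g \<Longrightarrow> g \<circ> inv g = id"
  by (simp_all add: fun_eq_iff taut_f_inv[of g])

lemma taut_inj_eq: "taut g \<Longrightarrow> g u = g v \<longleftrightarrow> u = v"
  using inj_eq[OF bij_is_inj[OF taut_bij]] .

lemma sect_append: "sect g (u @ v) = sect (sect g u) v"
  by (simp add: sect_def fun_eq_iff add.commute)

lemma sect_Nil [simp]: "sect g [] = g"
  by (simp add: sect_def)

lemma sect_id [simp]: "sect id u = id"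
  by (simp add: sect_def fun_eq_iff)

lemma taut_id [simp]: "taut id"
  by (simp add: taut_def)

lemma sect_comp:
  assumes "taut f" "taut g" shows "sect (f \<circ> g) u = sect f (g u) \<circ> sect g u"
proof
  fix w
  have "(f \<circ> g) (u @ w) = f (g u) @ sect f (g u) (sect g u w)"
    unfolding comp_apply taut_append[OF assms(2)] by (rule taut_append[OF assms(1)])
  then show "sect (f \<circ> g) u w = (sect f (g u) \<circ> sect g u) w"
    by (simp add: sect_def[of "f \<circ> g"] taut_length[OF assms(1)] taut_length[OF assms(2)])
qed

lemma taut_comp:
  assumes f: "taut f" and g: "taut g" shows "taut (f \<circ> g)"
  unfolding taut_def
proof (intro conjI allI)
  show "bij (f \<circ> g)" using f g by (simp add: bij_comp taut_bij)
  show "length ((f \<circ> g) u) = length u" for u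
    by (simp add: taut_length[OF f] taut_length[OF g])
  show "(f \<circ> g) (u @ w) = (f \<circ> g) u @ sect (f \<circ> g) u w" for u w
    unfolding sect_comp[OF f g] comp_apply taut_append[OF g] by (rule taut_append[OF f])
qed

lemma taut_inv:
  assumes "taut g" shows "taut (inv g)"
proof -
  have len: "length (inv g u) = length u" for u
    using taut_length[OF assms, of "inv g u"] taut_f_inv[OF assms] by simp
  have "inv g (u @ w) = inv g u @ sect (inv g) u w" for u w
  proof -
    define a b where "a = take (length u) (inv g (u @ w))" and "b = drop (length u) (inv g (u @ w))"
    have ab: "inv g (u @ w) = a @ b" and la: "length a = length u"
      by (simp_all add: a_def b_def len)
    have "g a @ sect g a b = u @ w"
      using ab taut_append[OF assms, of a b] assms by (metis taut_f_inv)
    then have "g a = u" using la assms by (metis append_eq_append_conv taut_length)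
    then have "a = inv g u" using assms by auto
    then show ?thesis using ab by (simp add: sect_def b_def)
  qed
  with len show ?thesis using assms by (simp add: taut_def[of "inv g"] bij_imp_bij_inv taut_bij)
qed

lemma taut_sect:
  assumes g: "taut g" shows "taut (sect g u)"
proof -
  have "inj (sect g u)"
    by (rule injI) (metis g taut_append taut_inj_eq same_append_eq)
  moreover have "surj (sect g u)"
  proof (rule surjI)
    fix w
    have "inv g (g u @ w) = u @ sect (inv g) (g u) w"
      using taut_append[OF taut_inv[OF g], of "g u" w] g by simp
    then have "g u @ w = g u @ sect g u (sect (inv g) (g u) w)"
      using taut_append[OF g] g by (metis taut_f_inv)
    then show "sect g u (sect (inv g) (g u) w) = w" by simp
  qed
  moreover have "sect g u (v @ w) = sect g u v @ sect (sect g u) v w" for v w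
  proof -
    have "g u @ sect g u (v @ w) = (g u @ sect g u v) @ sect g (u @ v) w"
      using taut_append[OF g, of u "v @ w"] taut_append[OF g, of "u @ v" w]
        taut_append[OF g, of u v] by simp
    then show ?thesis by (simp add: sect_append)
  qed
  moreover have "length (sect g u w) = length w" for w
    by (simp add: sect_def taut_length[OF g])
  ultimately show ?thesis by (simp add: taut_def bij_def)
qed

lemma sect_inv:
  assumes "taut g" shows "sect (inv g) (g u) = inv (sect g u)"
proof -
  have "sect (inv g) (g u) \<circ> sect g u = id"
    using sect_comp[OF taut_inv[OF assms] assms, of u] assms by simp
  then have "sect (inv g) (g u) \<circ> (sect g u \<circ> inv (sect g u)) = inv (sect g u)"
    by (metis comp_assoc id_comp)
  then show ?thesis using taut_sect[OF assms] by simp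
qed

definition taut_group :: "('x list \<Rightarrow> 'x list) set \<Rightarrow> bool" where
  "taut_group H \<longleftrightarrow> id \<in> H \<and> (\<forall>f\<in>H. \<forall>g\<in>H. f \<circ> g \<in> H) \<and> (\<forall>f\<in>H. inv f \<in> H) \<and> (\<forall>f\<in>H. taut f)"

lemma taut_group_id: "taut_group H \<Longrightarrow> id \<in> H"
  and taut_group_comp: "taut_group H \<Longrightarrow> f \<in> H \<Longrightarrow> g \<in> H \<Longrightarrow> f \<circ> g \<in> H"
  and taut_group_inv: "taut_group H \<Longrightarrow> f \<in> H \<Longrightarrow> inv f \<in> H"
  and taut_group_taut: "taut_group H \<Longrightarrow> f \<in> H \<Longrightarrow> taut f"
  by (simp_all add: taut_group_def)

definition vsec :: "('x list \<Rightarrow> 'x list) set \<Rightarrow> 'x list \<Rightarrow> ('x list \<Rightarrow> 'x list) set" where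
  "vsec H y = psi y (stab H {y})"

lemma mem_vsec: "f \<in> vsec H y \<longleftrightarrow> (\<exists>g\<in>H. g y = y \<and> f = sect g y)"
  by (auto simp: vsec_def psi_def stab_def)

lemma vsecI: "g \<in> H \<Longrightarrow> g y = y \<Longrightarrow> sect g y \<in> vsec H y"
  by (auto simp: mem_vsec)

text \<open>Among elements that fix \<open>y\<close>, taking the section at \<open>y\<close> is
  multiplicative and commutes with inverses.\<close>

lemma taut_group_psi_stab:
  assumes H: "taut_group H" and y: "y \<in> Y" shows "taut_group (psi y (stab H Y))"
proof -
  have mem: "f \<in> psi y (stab H Y) \<longleftrightarrow> (\<exists>g\<in>H. (\<forall>z\<in>Y. g z = z) \<and> f = sect g y)" for f
    by (auto simp: psi_def stab_def)
  show ?thesis unfolding taut_group_def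
  proof (intro conjI ballI)
    show "id \<in> psi y (stab H Y)" using taut_group_id[OF H] unfolding mem by (metis id_apply sect_id)
  next
    fix f f' assume "f \<in> psi y (stab H Y)" "f' \<in> psi y (stab H Y)"
    then obtain g g' where g: "g \<in> H" "\<forall>z\<in>Y. g z = z" "f = sect g y" "g' \<in> H" "\<forall>z\<in>Y. g' z = z" "f' = sect g' y"
      unfolding mem by blast
    then show "f \<circ> f' \<in> psi y (stab H Y)" unfolding mem
      using y by (intro bexI[of _ "g \<circ> g'"]) (auto simp: sect_comp taut_group_taut[OF H] taut_group_comp[OF H])
  next
    fix f assume "f \<in> psi y (stab H Y)"
    then obtain g where g: "g \<in> H" "\<forall>z\<in>Y. g z = z" "f = sect g y" unfolding mem by blast
    then have "taut g" using H taut_group_taut by blast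
    show "inv f \<in> psi y (stab H Y)" unfolding mem
    proof (intro bexI[of _ "inv g"] conjI ballI)
      show "inv g z = z" if "z \<in> Y" for z using g(2) that \<open>taut g\<close> by (metis taut_inv_f)
      show "inv f = sect (inv g) y" using sect_inv[OF \<open>taut g\<close>, of y] g y by simp
      show "inv g \<in> H" using g H taut_group_inv by blast
    qed
    show "taut f" using g taut_sect \<open>taut g\<close> by blast
  qed
qed

lemma taut_group_vsec: "taut_group H \<Longrightarrow> taut_group (vsec H y)"
  by (simp add: vsec_def taut_group_psi_stab)

text \<open>An element fixes \<open>u @ v\<close> exactly if it fixes \<open>u\<close> and its
  section at \<open>u\<close> fixes \<open>v\<close>, so stabilizing in one step or in two selects
  the same elements.\<close>

lemma vsec_append:
  assumes H: "taut_group H" shows "vsec H (u @ v) = vsec (vsec H u) v"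
proof -
  have eq: "g (u @ v) = u @ v \<longleftrightarrow> g u = u \<and> sect g u v = v" if "g \<in> H" for g
    using taut_append[OF taut_group_taut[OF H that], of u v] taut_length[OF taut_group_taut[OF H that], of u]
    by auto
  show ?thesis
  proof (intro set_eqI iffI)
    fix f assume "f \<in> vsec H (u @ v)"
    then obtain g where g: "g \<in> H" "g (u @ v) = u @ v" "f = sect (sect g u) v"
      unfolding mem_vsec sect_append by blast
    then have "g u = u" "sect g u v = v" using eq by auto
    then show "f \<in> vsec (vsec H u) v" using g by (simp add: vsecI)
  next
    fix f assume "f \<in> vsec (vsec H u) v"
    then obtain h where h: "h \<in> vsec H u" "h v = v" "f = sect h v" by (auto simp: mem_vsec)
    then obtain g where "g \<in> H" "g u = u" "h = sect g u" by (auto simp: mem_vsec)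
    then show "f \<in> vsec H (u @ v)" using eq h vsecI[of g H "u @ v"] by (simp add: sect_append)
  qed
qed

lemma vsec_Nil: "taut_group H \<Longrightarrow> vsec H [] = H"
  using taut_Nil[OF taut_group_taut] unfolding set_eq_iff mem_vsec sect_Nil by blast

section \<open>Conjugate groups and vertices in one orbit\<close>

definition conj_by :: "('x list \<Rightarrow> 'x list) \<Rightarrow> ('x list \<Rightarrow> 'x list) set \<Rightarrow> ('x list \<Rightarrow> 'x list) set" where
  "conj_by f K = (\<lambda>k. f \<circ> k \<circ> inv f) ` K"

lemma conj_byI: "k \<in> K \<Longrightarrow> f \<circ> k \<circ> inv f \<in> conj_by f K"
  by (auto simp: conj_by_def)

lemma taut_group_conj_by:
  assumes K: "taut_group K" and f: "taut f" shows "taut_group (conj_by f K)"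
proof -
  have comp: "(f \<circ> k \<circ> inv f) \<circ> (f \<circ> l \<circ> inv f) = f \<circ> (k \<circ> l) \<circ> inv f" for k l
    using f by (simp add: fun_eq_iff)
  have inv: "inv (f \<circ> k \<circ> inv f) = f \<circ> inv k \<circ> inv f" if "k \<in> K" for k
  proof -
    have "taut k" using that K taut_group_taut by blast
    then show ?thesis using f by (intro inv_unique_comp) (simp_all add: fun_eq_iff taut_f_inv[of f] taut_f_inv[of k])
  qed
  show ?thesis unfolding taut_group_def
  proof (intro conjI ballI)
    show "id \<in> conj_by f K" using conj_byI[OF taut_group_id[OF K], of f] f by simp
  next
    fix x y assume "x \<in> conj_by f K" "y \<in> conj_by f K"
    then show "x \<circ> y \<in> conj_by f K"
      unfolding conj_by_def using comp taut_group_comp[OF K] by (auto simp: image_iff)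
  next
    fix x assume x: "x \<in> conj_by f K"
    then show "inv x \<in> conj_by f K"
      unfolding conj_by_def using inv taut_group_inv[OF K] by (auto simp: image_iff)
    show "taut x" using x taut_group_taut[OF K] f by (auto simp: conj_by_def intro!: taut_comp taut_inv)
  qed
qed

lemma conj_cancel:
  assumes "taut f" shows "inv f \<circ> (f \<circ> k \<circ> inv f) \<circ> inv (inv f) = k"
  using assms by (simp add: fun_eq_iff inv_inv_eq taut_bij)

lemma conj_by_inv:
  assumes "taut f" shows "conj_by (inv f) (conj_by f K) = K"
  unfolding conj_by_def using conj_cancel[OF assms] by (simp only: image_image image_ident)

lemma conj_by_self:
  assumes K: "taut_group K" and f: "f \<in> K" shows "conj_by f K = K"
proof
  show "conj_by f K \<subseteq> K" using K f by (auto simp: conj_by_def taut_group_comp taut_group_inv)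
  show "K \<subseteq> conj_by f K"
  proof
    fix k assume "k \<in> K"
    then have "inv f \<circ> k \<circ> f \<in> K" using K f by (simp add: taut_group_comp taut_group_inv)
    moreover have "k = f \<circ> (inv f \<circ> k \<circ> f) \<circ> inv f"
      using taut_f_inv[OF taut_group_taut[OF K f]] by (simp add: fun_eq_iff)
    ultimately show "k \<in> conj_by f K" unfolding conj_by_def by blast
  qed
qed

lemma sect_conj:
  assumes "taut f" "taut k" "k y = y"
  shows "sect (f \<circ> k \<circ> inv f) (f y) = sect f y \<circ> sect k y \<circ> inv (sect f y)"
  using assms by (simp add: sect_comp taut_comp taut_inv sect_inv comp_assoc)

text \<open>Conjugation by \<open>f\<close> carries the stabilizer of \<open>y\<close> to that of
  \<open>f y\<close>; on sections it becomes conjugation by \<open>sect f y\<close>. For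
  \<open>f\<close> in the group itself this compares the vertices of an orbit.\<close>

lemma vsec_conj_by:
  assumes K: "taut_group K" and f: "taut f"
  shows "vsec (conj_by f K) (f y) = conj_by (sect f y) (vsec K y)"
proof -
  have fx: "(f \<circ> k \<circ> inv f) (f y) = f y \<longleftrightarrow> k y = y" for k
    using f by (simp add: taut_inj_eq)
  have sec: "sect (f \<circ> k \<circ> inv f) (f y) = sect f y \<circ> sect k y \<circ> inv (sect f y)"
    if "k \<in> K" "k y = y" for k
    using sect_conj[OF f taut_group_taut[OF K]] that by blast
  show ?thesis
  proof (intro set_eqI iffI)
    fix x assume "x \<in> vsec (conj_by f K) (f y)"
    then obtain k where "k \<in> K" "(f \<circ> k \<circ> inv f) (f y) = f y" "x = sect (f \<circ> k \<circ> inv f) (f y)"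
      by (auto simp: mem_vsec conj_by_def)
    then have "x = sect f y \<circ> sect k y \<circ> inv (sect f y)" "sect k y \<in> vsec K y"
      using sec fx unfolding mem_vsec by blast+
    then show "x \<in> conj_by (sect f y) (vsec K y)" by (simp add: conj_byI)
  next
    fix x assume "x \<in> conj_by (sect f y) (vsec K y)"
    then obtain k where k: "k \<in> K" "k y = y" "x = sect f y \<circ> sect k y \<circ> inv (sect f y)"
      by (auto simp: mem_vsec conj_by_def)
    then have "x = sect (f \<circ> k \<circ> inv f) (f y)" "(f \<circ> k \<circ> inv f) (f y) = f y"
      using sec fx by metis+
    then show "x \<in> vsec (conj_by f K) (f y)"
      unfolding mem_vsec using conj_byI[OF k(1), of f] by blast
  qed
qed

lemma vsec_orbit:
  assumes K: "taut_group K" and k: "k \<in> K"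
  shows "vsec K (k y) = conj_by (sect k y) (vsec K y)"
  using vsec_conj_by[OF K taut_group_taut[OF K k], of y] conj_by_self[OF K k] by simp

section \<open>Level transitivity\<close>

definition level_transitive :: "('x list \<Rightarrow> 'x list) set \<Rightarrow> bool" where
  "level_transitive H \<longleftrightarrow> (\<forall>u v. length u = length v \<longrightarrow> (\<exists>h\<in>H. h u = v))"

lemma level_transitiveD: "level_transitive H \<Longrightarrow> length u = length v \<Longrightarrow> \<exists>h\<in>H. h u = v"
  by (simp add: level_transitive_def)

text \<open>An element taking \<open>y @ u\<close> to \<open>y @ v\<close> must fix
  \<open>y\<close>, and then its section at \<open>y\<close> takes \<open>u\<close> to
  \<open>v\<close>.\<close>

lemma level_transitive_vsec:
  assumes H: "taut_group H" and l: "level_transitive H" shows "level_transitive (vsec H y)"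
  unfolding level_transitive_def
proof (intro allI impI)
  fix u v :: "'a list" assume "length u = length v"
  then obtain h where h: "h \<in> H" "h (y @ u) = y @ v"
    using level_transitiveD[OF l, of "y @ u" "y @ v"] by auto
  then have "h y @ sect h y u = y @ v" using taut_append[OF taut_group_taut[OF H h(1)]] by simp
  then have "h y = y" "sect h y u = v"
    using taut_length[OF taut_group_taut[OF H h(1)], of y] by auto
  then show "\<exists>f\<in>vsec H y. f u = v" using h(1) by (intro bexI[of _ "sect h y"] vsecI)
qed

lemma level_transitive_conj_by:
  assumes l: "level_transitive K" and f: "taut f" shows "level_transitive (conj_by f K)"
  unfolding level_transitive_def
proof (intro allI impI)
  fix u v :: "'a list" assume "length u = length v"
  then obtain k where "k \<in> K" "k (inv f u) = inv f v"
    using level_transitiveD[OF l, of "inv f u" "inv f v"] taut_length[OF taut_inv[OF f]] by auto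
  then show "\<exists>h\<in>conj_by f K. h u = v"
    using f by (intro bexI[of _ "f \<circ> k \<circ> inv f"] conj_byI) (auto simp: taut_f_inv[of f])
qed

section \<open>Generated groups and finite index\<close>

lemma gen_grp_superset: "s \<in> S \<Longrightarrow> s \<in> gen_grp S"
  using gen_mul[OF _ gen_id, of s S] by simp

lemma gen_grp_comp:
  assumes "f \<in> gen_grp S" and g: "g \<in> gen_grp S" shows "f \<circ> g \<in> gen_grp S"
  by (rule gen_grp.induct[OF assms(1), where P = "\<lambda>f. f \<circ> g \<in> gen_grp S"])
    (simp_all only: id_comp g comp_assoc gen_grp.intros)

lemma gen_grp_least:
  assumes G: "taut_group G" "S \<subseteq> G" shows "gen_grp S \<subseteq> G"
proof
  fix f assume "f \<in> gen_grp S"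
  then show "f \<in> G"
    by (rule gen_grp.induct)
      (use G in \<open>blast intro: taut_group_id taut_group_comp taut_group_inv\<close>)+
qed

lemma taut_group_gen_grp:
  assumes S: "\<And>s. s \<in> S \<Longrightarrow> taut s" shows "taut_group (gen_grp S)"
proof -
  have inv: "inv s \<in> gen_grp S" if "s \<in> S" for s
    using gen_grp.gen_inv[OF that gen_grp.gen_id] by simp
  have t: "taut f \<and> inv f \<in> gen_grp S" if "f \<in> gen_grp S" for f
  proof (rule gen_grp.induct[OF that, where P = "\<lambda>f. taut f \<and> inv f \<in> gen_grp S"])
    show "taut id \<and> inv id \<in> gen_grp S" by (simp only: taut_id inv_id gen_grp.gen_id simp_thms)
  next
    fix s f assume *: "s \<in> S" "f \<in> gen_grp S" "taut f \<and> inv f \<in> gen_grp S"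
    have "inv (s \<circ> f) = inv f \<circ> inv s" and "inv (inv s \<circ> f) = inv f \<circ> s"
      using * S[of s] by (simp_all add: o_inv_distrib taut_bij bij_imp_bij_inv inv_inv_eq)
    then show "taut (s \<circ> f) \<and> inv (s \<circ> f) \<in> gen_grp S"
      and "taut (inv s \<circ> f) \<and> inv (inv s \<circ> f) \<in> gen_grp S"
      using * S[of s] inv[of s] gen_grp_superset[of s S]
      by (simp_all only: taut_comp taut_inv gen_grp_comp simp_thms)
  qed
  then show ?thesis using gen_grp_comp gen_grp.gen_id unfolding taut_group_def by blast
qed

text \<open>Two elements that agree on \<open>Y\<close> differ by an element of
  \<open>stab H Y\<close>, so the coset of \<open>sect h y\<close> depends only on the action of
  \<open>h\<close> on the finite set \<open>Y\<close>. Since \<open>vsec H y = G\<close>, every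
  coset arises in this way.\<close>

lemma finite_index_psi_stab:
  assumes H: "taut_group H" and Y: "finite Y" "\<And>h z. h \<in> H \<Longrightarrow> z \<in> Y \<Longrightarrow> h z \<in> Y"
    and y: "y \<in> Y" and G: "vsec H y = G"
  shows "finite_index_subgroup (psi y (stab H Y)) G"
proof -
  let ?K = "psi y (stab H Y)"
  have K: "taut_group ?K" by (rule taut_group_psi_stab[OF H y])
  have KG: "?K \<subseteq> G" using y by (auto simp: G[symmetric] vsec_def psi_def stab_def)
  define c where "c h = (\<lambda>k. sect h y \<circ> k) ` ?K" for h
  \<comment> \<open>\<open>restrict\<close> fixes the values outside \<open>Y\<close>: equality of
    \<open>\<rho> h\<close> and \<open>\<rho> h'\<close> is agreement on \<open>Y\<close>, and the
    values lie in a finite extensional function space.\<close>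
  define \<rho> where "\<rho> h = restrict h Y" for h :: "'a list \<Rightarrow> 'a list"
  have sub: "c h \<subseteq> c h'" if "h \<in> stab H {y}" "h' \<in> stab H {y}" "\<rho> h = \<rho> h'" for h h'
  proof
    fix f assume "f \<in> c h"
    then obtain k where k: "k \<in> ?K" "f = sect h y \<circ> k" by (auto simp: c_def)
    have h: "h \<in> H" "h y = y" "h' \<in> H" "h' y = y" using that by (auto simp: stab_def)
    have eq: "h z = h' z" if "z \<in> Y" for z
      using fun_cong[OF \<open>\<rho> h = \<rho> h'\<close>, of z] that by (simp add: \<rho>_def)
    have th: "taut h'" "taut h" using h H taut_group_taut by blast+
    let ?m = "inv h' \<circ> h"
    have mH: "?m \<in> H" using h H by (simp add: taut_group_comp taut_group_inv)
    have "?m \<in> stab H Y" using mH eq th by (auto simp: stab_def)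
    then have "sect ?m y \<in> ?K" by (auto simp: psi_def)
    then have mk: "sect ?m y \<circ> k \<in> ?K" using k(1) K by (simp add: taut_group_comp)
    have "h' \<circ> ?m = h" using taut_f_inv[OF th(1)] by (simp add: fun_eq_iff)
    then have "sect h y = sect h' (?m y) \<circ> sect ?m y"
      using sect_comp[OF th(1) taut_group_taut[OF H mH], of y] by simp
    moreover have "?m y = y" using eq[OF y] th by simp
    ultimately have "f = sect h' y \<circ> (sect ?m y \<circ> k)" using k(2) by (simp add: comp_assoc)
    then show "f \<in> c h'" unfolding c_def using mk by (rule image_eqI)
  qed
  have "\<rho> ` stab H {y} \<subseteq> Y \<rightarrow>\<^sub>E Y" using Y(2) by (auto simp: \<rho>_def stab_def)
  then have "finite (\<rho> ` stab H {y})"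
    by (rule finite_subset) (use Y in \<open>intro finite_PiE\<close>)
  \<comment> \<open>One representative for each value of \<open>\<rho>\<close> already yields all
    cosets.\<close>
  moreover have "c ` stab H {y} \<subseteq> (\<lambda>\<phi>. c (SOME h. h \<in> stab H {y} \<and> \<rho> h = \<phi>)) ` \<rho> ` stab H {y}"
  proof
    fix C assume "C \<in> c ` stab H {y}"
    then obtain h where h: "h \<in> stab H {y}" "C = c h" by blast
    define h' where "h' = (SOME h'. h' \<in> stab H {y} \<and> \<rho> h' = \<rho> h)"
    have h': "h' \<in> stab H {y}" "\<rho> h' = \<rho> h"
      using someI[of "\<lambda>h'. h' \<in> stab H {y} \<and> \<rho> h' = \<rho> h" h] h(1) by (auto simp: h'_def)
    then have "C = c h'" using sub[of h h'] sub[of h' h] h by auto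
    then show "C \<in> (\<lambda>\<phi>. c (SOME h. h \<in> stab H {y} \<and> \<rho> h = \<phi>)) ` \<rho> ` stab H {y}"
      using h(1) by (auto simp: h'_def)
  qed
  ultimately have "finite (c ` stab H {y})" by (meson finite_imageI finite_subset)
  moreover have "{(\<lambda>k. g \<circ> k) ` ?K | g. g \<in> G} = c ` stab H {y}"
    by (auto simp: G[symmetric] vsec_def c_def psi_def)
  ultimately show ?thesis
    using K KG unfolding finite_index_subgroup_def taut_group_def by simp
qed

section \<open>Groups given by words\<close>

primrec weval :: "('l \<Rightarrow> 'a \<Rightarrow> 'a) \<Rightarrow> 'l list \<Rightarrow> 'a \<Rightarrow> 'a" where
  "weval e [] = id"
| "weval e (l # w) = e l \<circ> weval e w"

lemma weval_append: "weval e (u @ v) = weval e u \<circ> weval e v"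
  by (induction u) (simp_all add: comp_assoc)

primrec wsec :: "('l \<Rightarrow> 'x \<Rightarrow> 'x) \<Rightarrow> ('l \<Rightarrow> 'x \<Rightarrow> 'l list) \<Rightarrow> 'l list \<Rightarrow> 'x \<Rightarrow> 'l list" where
  "wsec la ls [] x = []"
| "wsec la ls (l # w) x = ls l (weval la w x) @ wsec la ls w x"

lemma wsec_append: "wsec la ls (u @ v) x = wsec la ls u (weval la v x) @ wsec la ls v x"
  by (induction u) (simp_all add: weval_append)

text \<open>A self-similar group presented by letters: \<open>lact\<close> and \<open>lsec\<close>
  give the action on the first letter and the sections as words, and \<open>wt_lsec\<close> is the
  additivity of the weight. Inverses are words, not letters, so that the inverse of the Gupta--Sidki
  \<open>a\<close> can be \<open>a\<close> twice.\<close>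

locale word_group =
  fixes ev :: "'l \<Rightarrow> 'x list \<Rightarrow> 'x list" and lact :: "'l \<Rightarrow> 'x \<Rightarrow> 'x" and lsec :: "'l \<Rightarrow> 'x \<Rightarrow> 'l list"
    and wt :: "'l \<Rightarrow> nat"
  assumes ev_Nil: "ev l [] = []"
    and ev_Cons: "ev l (x # v) = lact l x # weval ev (lsec l x) v"
    and ev_inverse: "\<exists>w. ev l \<circ> weval ev w = id \<and> weval ev w \<circ> ev l = id"
    and finite_alphabet: "finite (UNIV :: 'x set)"
    and wt_lsec: "(\<Sum>x\<in>UNIV. sum_list (map wt (lsec l x))) = wt l"
begin

abbreviation eval :: "'l list \<Rightarrow> 'x list \<Rightarrow> 'x list" where "eval \<equiv> weval ev"
abbreviation act :: "'l list \<Rightarrow> 'x \<Rightarrow> 'x" where "act \<equiv> weval lact"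
abbreviation sec :: "'l list \<Rightarrow> 'x \<Rightarrow> 'l list" where "sec \<equiv> wsec lact lsec"
abbreviation weight :: "'l list \<Rightarrow> nat" where "weight w \<equiv> sum_list (map wt w)"
abbreviation G :: "('x list \<Rightarrow> 'x list) set" where "G \<equiv> range eval"

lemma eval_Nil: "eval w [] = []"
  by (induction w) (simp_all add: ev_Nil)

lemma eval_Cons: "eval w (x # v) = act w x # eval (sec w x) v"
  by (induction w) (simp_all add: ev_Cons weval_append)

lemma length_eval: "length (eval w v) = length v"
  by (induction v arbitrary: w) (simp_all add: eval_Nil eval_Cons)

lemma take_eval: "take (length u) (eval w (u @ v)) = eval w u"
  by (induction u arbitrary: w) (simp_all add: eval_Nil eval_Cons)

lemma eval_inverse: "\<exists>w'. eval w \<circ> eval w' = id \<and> eval w' \<circ> eval w = id"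
proof (induction w)
  case Nil show ?case by (intro exI[of _ "[]"]) simp
next
  case (Cons l w)
  then obtain w' where w': "eval w \<circ> eval w' = id" "eval w' \<circ> eval w = id" by blast
  obtain l' where l': "ev l \<circ> eval l' = id" "eval l' \<circ> ev l = id" using ev_inverse by blast
  have "eval (l # w) \<circ> eval (w' @ l') = ev l \<circ> (eval w \<circ> eval w') \<circ> eval l'"
    by (simp add: weval_append comp_assoc)
  moreover have "eval (w' @ l') \<circ> eval (l # w) = eval w' \<circ> (eval l' \<circ> ev l) \<circ> eval w"
    by (simp add: weval_append comp_assoc)
  ultimately have "eval (l # w) \<circ> eval (w' @ l') = id \<and> eval (w' @ l') \<circ> eval (l # w) = id"
    by (simp only: w' l' comp_id id_comp simp_thms)
  then show ?case by blast
qed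

lemma taut_eval: "taut (eval w)"
  unfolding taut_def
proof (intro conjI allI)
  show "bij (eval w)" using eval_inverse o_bij by blast
  show "length (eval w u) = length u" for u by (rule length_eval)
  show "eval w (u @ v) = eval w u @ sect (eval w) u v" for u v
    unfolding sect_def using take_eval[of u w v] append_take_drop_id[of "length u" "eval w (u @ v)"] by simp
qed

lemma inv_eval: "\<exists>w'. inv (eval w) = eval w'"
  using eval_inverse[of w] by (metis inv_unique_comp)

lemma sect_eval: "sect (eval w) [x] = eval (sec w x)"
  by (simp add: sect_def fun_eq_iff eval_Cons)

lemma taut_group_G: "taut_group G"
  unfolding taut_group_def
proof (intro conjI ballI)
  show "id \<in> G" by (metis rangeI weval.simps(1))
  show "f \<circ> g \<in> G" if "f \<in> G" "g \<in> G" for f g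
    using that by (auto simp: weval_append[symmetric])
  show "inv f \<in> G" if "f \<in> G" for f using that inv_eval by auto
  show "taut f" if "f \<in> G" for f using that taut_eval by auto
qed

lemma sect_G: "g \<in> G \<Longrightarrow> sect g u \<in> G"
proof (induction u arbitrary: g)
  case (Cons x u)
  then have "sect g [x] \<in> G" using sect_eval by auto
  then show ?case using Cons.IH sect_append[of g "[x]" u] by simp
qed simp

lemma vsec_subset_G: "H \<subseteq> G \<Longrightarrow> vsec H y \<subseteq> G"
  using sect_G unfolding mem_vsec subset_iff by blast

lemma bij_act: "bij (act w)"
proof -
  have "inj (act w)"
  proof (rule injI)
    fix x y assume "act w x = act w y"
    then have "eval w [x] = eval w [y]" by (simp add: eval_Cons eval_Nil)
    then show "x = y" using taut_inj_eq[OF taut_eval] by blast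
  qed
  then show ?thesis using finite_alphabet by (simp add: bij_def finite_UNIV_inj_surj)
qed

lemma weight_sec: "(\<Sum>x\<in>UNIV. weight (sec w x)) = weight w"
proof (induction w)
  case (Cons l w)
  have "(\<Sum>x\<in>UNIV. weight (lsec l (act w x))) = (\<Sum>x\<in>UNIV. weight (lsec l x))"
    using sum.reindex_bij_betw[OF bij_act[of w], of "\<lambda>x. weight (lsec l x)"] by simp
  then show ?case using Cons wt_lsec[of l] by (simp add: sum.distrib)
qed simp

definition has_full_section :: "('x list \<Rightarrow> 'x list) set \<Rightarrow> bool" where
  "has_full_section K \<longleftrightarrow> (\<exists>z. vsec K z = G)"

lemma has_full_section_vsec:
  assumes "taut_group K" "has_full_section (vsec K y)" shows "has_full_section K"
proof -
  obtain z where "vsec (vsec K y) z = G" using assms(2) unfolding has_full_section_def by blast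
  then have "vsec K (y @ z) = G" by (simp only: vsec_append[OF assms(1)])
  then show ?thesis unfolding has_full_section_def by blast
qed

text \<open>The conjugator and its sections lie in \<open>G\<close>, and conjugation by an element
  of \<open>G\<close> maps \<open>G\<close> onto itself, so it can be undone at the full
  vertex.\<close>

lemma has_full_section_conj_by:
  assumes K: "taut_group K" and g: "g \<in> G" and full: "has_full_section (conj_by g K)"
  shows "has_full_section K"
proof -
  have tg: "taut g" using g taut_eval by blast
  obtain z where z: "vsec (conj_by g K) z = G" using full unfolding has_full_section_def by blast
  let ?y = "inv g z"
  let ?f = "sect g ?y"
  have f: "?f \<in> G" "taut ?f" using g sect_G taut_group_taut[OF taut_group_G] by blast+
  have "G = conj_by ?f (vsec K ?y)"
    using vsec_conj_by[OF K tg, of ?y] z taut_f_inv[OF tg] by simp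
  then have "vsec K ?y = conj_by (inv ?f) G" using conj_by_inv[OF f(2)] by simp
  also have "\<dots> = G" using conj_by_self[OF taut_group_G] taut_group_inv[OF taut_group_G f(1)] by blast
  finally show ?thesis unfolding has_full_section_def by blast
qed

lemma has_full_section_G:
  assumes "taut_group K" "K = G" shows "has_full_section K"
  unfolding has_full_section_def using vsec_Nil[OF assms(1)] assms(2) by (intro exI[of _ "[]"]) simp

lemma vsec_eval:
  assumes "eval w \<in> K" "act w x = x" shows "eval (sec w x) \<in> vsec K [x]"
  using vsecI[OF assms(1), of "[x]"] assms(2) by (simp add: sect_eval eval_Cons eval_Nil)

lemma conj_by_subset_G:
  assumes "K \<subseteq> G" "g \<in> G" shows "conj_by g K \<subseteq> G"
proof
  fix f assume "f \<in> conj_by g K"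
  then obtain k where "k \<in> K" "f = g \<circ> k \<circ> inv g" unfolding conj_by_def by blast
  then show "f \<in> G"
    using assms by (auto intro!: taut_group_comp[OF taut_group_G] taut_group_inv[OF taut_group_G])
qed

section \<open>Weights of group elements\<close>

definition elt_weight :: "('x list \<Rightarrow> 'x list) \<Rightarrow> nat" where
  "elt_weight g = (LEAST n. \<exists>w. eval w = g \<and> weight w = n)"

lemma elt_weight_witness: "g \<in> G \<Longrightarrow> \<exists>w. eval w = g \<and> weight w = elt_weight g"
  unfolding elt_weight_def by (rule LeastI_ex) auto

lemma elt_weight_le: "elt_weight (eval w) \<le> weight w"
  unfolding elt_weight_def by (rule Least_le) auto

text \<open>The sections of a word of least weight represent the sections of \<open>g\<close>, but
  need not have least weight themselves; hence an inequality where words have an equality.\<close>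

lemma elt_weight_sect: assumes "g \<in> G" shows "(\<Sum>x\<in>UNIV. elt_weight (sect g [x])) \<le> elt_weight g"
proof -
  obtain w where w: "eval w = g" "weight w = elt_weight g" using elt_weight_witness[OF assms] by blast
  have "(\<Sum>x\<in>UNIV. elt_weight (sect g [x])) \<le> (\<Sum>x\<in>UNIV. weight (sec w x))"
    by (rule sum_mono) (metis w(1) sect_eval elt_weight_le)
  then show ?thesis using weight_sec[of w] w(2) by simp
qed

lemma finite_level: "finite {v :: 'x list. length v = k}"
  using finite_lists_length_eq[OF finite_alphabet, of k] by simp

lemma elt_weight_level: "g \<in> G \<Longrightarrow> (\<Sum>v | length v = k. elt_weight (sect g v)) \<le> elt_weight g"
proof (induction k arbitrary: g)
  case 0
  have "{v :: 'x list. length v = 0} = {[]}" by auto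
  then show ?case by simp
next
  case (Suc k)
  have eq: "{v :: 'x list. length v = Suc k} = (\<lambda>(x, v). x # v) ` (UNIV \<times> {v. length v = k})"
    by (auto simp: length_Suc_conv image_iff)
  have "(\<Sum>v | length v = Suc k. elt_weight (sect g v)) = (\<Sum>(x, v)\<in>UNIV \<times> {v. length v = k}. elt_weight (sect g (x # v)))"
    unfolding eq by (subst sum.reindex) (auto simp: inj_on_def case_prod_unfold)
  also have "\<dots> = (\<Sum>x\<in>UNIV. \<Sum>v | length v = k. elt_weight (sect (sect g [x]) v))"
    by (simp add: sum.cartesian_product[symmetric] sect_append[of g "[_]", symmetric])
  also have "\<dots> \<le> (\<Sum>x\<in>UNIV. elt_weight (sect g [x]))"
    by (intro sum_mono Suc.IH sect_G Suc.prems)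
  also have "\<dots> \<le> elt_weight g" by (rule elt_weight_sect[OF Suc.prems])
  finally show ?case .
qed

end

section \<open>The alternative\<close>

text \<open>What has to be supplied for each group: the elements of weight 0 are finitely many and
  closed under inverses, every element of \<open>G\<close> recurs at each letter, and level
  transitive subgroups have a full section.\<close>

locale GN_group = word_group +
  assumes finite_weight_0: "finite (eval ` {w. weight w = 0})"
    and inv_weight_0: "weight w = 0 \<Longrightarrow> \<exists>w'. weight w' = 0 \<and> inv (eval w) = eval w'"
    and replicating: "g \<in> G \<Longrightarrow> g \<in> vsec G [x]"
    and level_transitive_full: "taut_group H \<Longrightarrow> H \<subseteq> G \<Longrightarrow> level_transitive H \<Longrightarrow> \<exists>y. vsec H y = G"
begin

lemma vsec_G: "vsec G y = G"
proof (induction y)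
  case Nil show ?case by (rule vsec_Nil[OF taut_group_G])
next
  case (Cons x y)
  have "vsec G [x] = G" using replicating vsec_subset_G by blast
  then show ?case using Cons vsec_append[OF taut_group_G, of "[x]" y] by simp
qed

context
  fixes S :: "('b list \<Rightarrow> 'b list) set"
  assumes finS: "finite S" and SG: "S \<subseteq> G"
begin

abbreviation (input) "H \<equiv> gen_grp S"

section \<open>Orbits of a finitely generated subgroup\<close>

definition orb :: "'b list \<Rightarrow> 'b list set" where "orb y = {h y |h. h \<in> H}"

text \<open>The number on which the induction runs. Over an infinite \<open>S\<close> the inner sum
  would be 0 by convention, so finite generation gives it its meaning.\<close>

definition cost :: "'b list \<Rightarrow> nat" where "cost y = (\<Sum>z\<in>orb y. \<Sum>t\<in>S. elt_weight (sect t z))"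

lemma group_H: "taut_group H"
  by (rule taut_group_gen_grp) (use SG taut_group_taut[OF taut_group_G] in blast)

lemma H_sub: "H \<subseteq> G"
  by (rule gen_grp_least[OF taut_group_G SG])

lemma H_taut: "h \<in> H \<Longrightarrow> taut h"
  using group_H taut_group_taut by blast

lemma orb_refl: "y \<in> orb y"
  unfolding orb_def using taut_group_id[OF group_H] by (intro CollectI exI[of _ id]) simp

lemma orb_closed:
  assumes "z \<in> orb y" "h \<in> H" shows "h z \<in> orb y"
proof -
  obtain g where "g \<in> H" "z = g y" using assms(1) unfolding orb_def by blast
  then show ?thesis unfolding orb_def using taut_group_comp[OF group_H assms(2)]
    by (intro CollectI exI[of _ "h \<circ> g"]) simp
qed

lemma orb_length: "z \<in> orb y \<Longrightarrow> length z = length y"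
  unfolding orb_def using taut_length[OF H_taut] by auto

lemma finite_orb: "finite (orb y)"
  by (rule finite_subset[OF _ finite_level[of "length y"]]) (use orb_length in blast)

lemma orb_eq: "z \<in> orb y \<Longrightarrow> z \<in> orb y' \<Longrightarrow> \<exists>h\<in>H. h y = y'"
proof -
  assume "z \<in> orb y" "z \<in> orb y'"
  then obtain h h' where h: "h \<in> H" "h' \<in> H" "h y = h' y'" unfolding orb_def by auto
  then have "(inv h' \<circ> h) y = y'" using H_taut by simp
  then show ?thesis using h taut_group_comp[OF group_H] taut_group_inv[OF group_H] by blast
qed

text \<open>Below each vertex \<open>z\<close> of the orbit, \<open>elt_weight_level\<close> bounds
  the weights of the sections on level \<open>k\<close> by the weight at \<open>z\<close>; summing
  over \<open>z\<close> and \<open>S\<close> bounds any set of such descendants.\<close>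

lemma cost_subset:
  assumes "D \<subseteq> {z @ v |z v. z \<in> orb y \<and> length v = k}"
  shows "(\<Sum>e\<in>D. \<Sum>t\<in>S. elt_weight (sect t e)) \<le> cost y"
proof -
  let ?E = "{z @ v |z v. z \<in> orb y \<and> length v = k}"
  have eq: "?E = (\<lambda>(z, v). z @ v) ` (orb y \<times> {v. length v = k})" by (auto simp: image_iff)
  have inj: "inj_on (\<lambda>(z, v). z @ v) (orb y \<times> {v. length v = k})"
    by (auto simp: inj_on_def)
  have "finite ?E" unfolding eq using finite_orb finite_level by (intro finite_imageI finite_cartesian_product)
  then have "(\<Sum>e\<in>D. \<Sum>t\<in>S. elt_weight (sect t e)) \<le> (\<Sum>e\<in>?E. \<Sum>t\<in>S. elt_weight (sect t e))"
    using assms by (intro sum_mono2) auto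
  also have "\<dots> = (\<Sum>(z, v)\<in>orb y \<times> {v. length v = k}. \<Sum>t\<in>S. elt_weight (sect t (z @ v)))"
    unfolding eq by (subst sum.reindex[OF inj]) (simp add: case_prod_unfold)
  also have "\<dots> = (\<Sum>z\<in>orb y. \<Sum>v | length v = k. \<Sum>t\<in>S. elt_weight (sect t (z @ v)))"
    by (rule sum.cartesian_product[symmetric])
  also have "\<dots> = (\<Sum>z\<in>orb y. \<Sum>t\<in>S. \<Sum>v | length v = k. elt_weight (sect (sect t z) v))"
    by (intro sum.cong refl) (subst sum.swap, simp add: sect_append)
  also have "\<dots> \<le> cost y"
    unfolding cost_def using SG by (intro sum_mono elt_weight_level sect_G) auto
  finally show ?thesis .
qed

lemma orb_append: "orb (y @ u) \<subseteq> {z @ v |z v. z \<in> orb y \<and> length v = length u}"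
proof
  fix e assume "e \<in> orb (y @ u)"
  then obtain h where h: "h \<in> H" "e = h (y @ u)" by (auto simp: orb_def)
  then have "e = h y @ sect h y u" using taut_append[OF H_taut] by blast
  moreover have "length (sect h y u) = length u" using taut_length[OF taut_sect[OF H_taut[OF h(1)]]] .
  moreover have "h y \<in> orb y" using h by (auto simp: orb_def)
  ultimately show "e \<in> {z @ v |z v. z \<in> orb y \<and> length v = length u}" by blast
qed

text \<open>Different orbits are disjoint and both lie \<open>length u\<close> levels below the
  orbit of \<open>y\<close>, so they share its cost.\<close>

lemma cost_append:
  assumes "length u = length u'" "\<not> (\<exists>h\<in>H. h (y @ u) = y @ u')"
  shows "cost (y @ u) + cost (y @ u') \<le> cost y"
proof -
  have "orb (y @ u) \<inter> orb (y @ u') = {}" using orb_eq assms(2) by blast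
  then have "cost (y @ u) + cost (y @ u') = (\<Sum>e\<in>orb (y @ u) \<union> orb (y @ u'). \<Sum>t\<in>S. elt_weight (sect t e))"
    unfolding cost_def by (intro sum.union_disjoint[symmetric] finite_orb)
  also have "\<dots> \<le> cost y"
    using orb_append[of y u] orb_append[of y u'] assms(1) by (intro cost_subset[of _ _ "length u"]) auto
  finally show ?thesis .
qed

text \<open>A section of an element of \<open>H\<close> is a product of sections of generators and
  their inverses along the orbit. Here all of these have weight 0, and such elements form the finite
  set \<open>?Z\<close>, closed under products and inverses.\<close>

lemma cost_0_finite:
  assumes "cost y = 0" shows "finite (psi y H)"
proof -
  let ?Z = "eval ` {w. weight w = 0}"
  have Z_comp: "f \<circ> g \<in> ?Z" if fg: "f \<in> ?Z" "g \<in> ?Z" for f g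
  proof -
    obtain u v where "f = eval u" "g = eval v" "weight u = 0" "weight v = 0" using fg by blast
    then have "f \<circ> g = eval (u @ v)" "u @ v \<in> {w. weight w = 0}" by (simp_all add: weval_append del: sum_list_eq_0_iff)
    then show ?thesis by (rule image_eqI)
  qed
  have Z_inv: "inv f \<in> ?Z" if f: "f \<in> ?Z" for f
  proof -
    obtain u where "f = eval u" "weight u = 0" using f by blast
    then show ?thesis using inv_weight_0[of u] by blast
  qed
  have gen: "sect t z \<in> ?Z" if "t \<in> S" "z \<in> orb y" for t z
  proof -
    have "elt_weight (sect t z) = 0" using assms that finite_orb finS by (simp add: cost_def)
    moreover have "sect t z \<in> G" using that SG sect_G by blast
    ultimately obtain w where w: "eval w = sect t z" "weight w = 0"
      using elt_weight_witness[of "sect t z"] by auto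
    have "eval w \<in> ?Z" by (rule imageI) (simp only: w(2) mem_Collect_eq)
    then show ?thesis by (simp only: w(1))
  qed
  have "\<forall>z\<in>orb y. sect h z \<in> ?Z" if "h \<in> H" for h
  proof (rule gen_grp.induct[OF that, where P = "\<lambda>h. \<forall>z\<in>orb y. sect h z \<in> ?Z"])
    have "eval [] \<in> ?Z" by (rule imageI) simp
    then show "\<forall>z\<in>orb y. sect id z \<in> ?Z" by (simp only: sect_id weval.simps) blast
  next
    fix s f assume s: "s \<in> S" and f: "f \<in> H" "\<forall>z\<in>orb y. sect f z \<in> ?Z"
    have t: "taut s" "taut f" "s \<in> H" using s f H_taut gen_grp_superset by blast+
    show "\<forall>z\<in>orb y. sect (s \<circ> f) z \<in> ?Z"
    proof
      fix z assume z: "z \<in> orb y"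
      show "sect (s \<circ> f) z \<in> ?Z" unfolding sect_comp[OF t(1,2)]
        using gen[OF s orb_closed[OF z f(1)]] f(2)[rule_format, OF z] by (rule Z_comp)
    qed
    show "\<forall>z\<in>orb y. sect (inv s \<circ> f) z \<in> ?Z"
    proof
      fix z assume z: "z \<in> orb y"
      \<comment> \<open>The section of \<open>inv s\<close> at \<open>f z\<close> is the inverse of
        the section of \<open>s\<close> at this vertex, which again lies in the orbit.\<close>
      let ?z = "inv s (f z)"
      have "?z \<in> orb y" using z f(1) t(3) orb_closed taut_group_inv[OF group_H] by blast
      then have "inv (sect s ?z) \<in> ?Z" using gen[OF s] Z_inv by blast
      then have "sect (inv s) (f z) \<in> ?Z"
        using sect_inv[OF t(1), of ?z] taut_f_inv[OF t(1)] by simp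
      then show "sect (inv s \<circ> f) z \<in> ?Z" unfolding sect_comp[OF taut_inv[OF t(1)] t(2)]
        using f(2)[rule_format, OF z] by (rule Z_comp)
    qed
  qed
  then have "psi y H \<subseteq> ?Z" using orb_refl unfolding psi_def by blast
  then show ?thesis using finite_weight_0 finite_subset by blast
qed

lemma full_below: "vsec H e = G \<Longrightarrow> vsec H (e @ v) = G"
  using vsec_append[OF group_H, of e v] vsec_G by simp

text \<open>Induction on the cost. Either every level below \<open>y\<close> is a single orbit, or
  some level splits; then either all vertices of that level are cheaper than \<open>y\<close>, or
  one orbit keeps the whole cost and another gets none.\<close>

lemma sections_finite_or_full:
  "(\<exists>z. finite (psi (y @ z) H)) \<or> (\<exists>N. \<forall>u. length u = N \<longrightarrow> vsec H (y @ u) = G)"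
proof (induction "cost y" arbitrary: y rule: less_induct)
  case less
  show ?case
  proof (cases "\<forall>u v. length u = length v \<longrightarrow> (\<exists>h\<in>H. h (y @ u) = y @ v)")
    case True
    have "level_transitive (vsec H y)" unfolding level_transitive_def
    proof (intro allI impI)
      fix u v :: "'b list" assume "length u = length v"
      then obtain h where h: "h \<in> H" "h (y @ u) = y @ v" using True by blast
      then have "h y @ sect h y u = y @ v" using taut_append[OF H_taut] by metis
      then have "h y = y" "sect h y u = v" using taut_length[OF H_taut[OF h(1)], of y] by auto
      then show "\<exists>f\<in>vsec H y. f u = v" using h(1) by (intro bexI[of _ "sect h y"] vsecI)
    qed
    then obtain z where z: "vsec (vsec H y) z = G"
      using level_transitive_full[OF taut_group_vsec[OF group_H] vsec_subset_G[OF H_sub]] by blast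
    \<comment> \<open>The vertices of this level lie in one orbit, so their groups are conjugate by
      elements of \<open>G\<close>.\<close>
    have "vsec H (y @ u) = G" if u: "length u = length z" for u
    proof -
      obtain h where h: "h \<in> H" "h (y @ z) = y @ u"
        using True[rule_format, OF u[symmetric]] by blast
      have "sect h (y @ z) \<in> G" using h H_sub sect_G by blast
      then have "conj_by (sect h (y @ z)) G = G" by (rule conj_by_self[OF taut_group_G])
      then show ?thesis using vsec_orbit[OF group_H h(1), of "y @ z"] h(2) z vsec_append[OF group_H, of y z] by simp
    qed
    then show ?thesis by blast
  next
    case False
    then obtain u u' where u: "length u = length u'" "\<not> (\<exists>h\<in>H. h (y @ u) = y @ u')" by blast
    let ?L = "{v :: 'b list. length v = length u}"
    show ?thesis
    proof (cases "\<forall>v\<in>?L. cost (y @ v) < cost y")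
      case True
      show ?thesis
      proof (cases "\<exists>v\<in>?L. \<exists>z. finite (psi ((y @ v) @ z) H)")
        case True
        then obtain v z where "finite (psi (y @ (v @ z)) H)" by auto
        then show ?thesis by blast
      next
        case False
        have "\<exists>N. \<forall>x. length x = N \<longrightarrow> vsec H ((y @ v) @ x) = G" if "v \<in> ?L" for v
          using less[of "y @ v"] True False that by blast
        then obtain N where N: "\<And>v x. v \<in> ?L \<Longrightarrow> length x = N v \<Longrightarrow> vsec H ((y @ v) @ x) = G"
          using bchoice[of ?L "\<lambda>v N. \<forall>x. length x = N \<longrightarrow> vsec H ((y @ v) @ x) = G"] by blast
        \<comment> \<open>The depths \<open>N v\<close> vary with \<open>v\<close>;
          \<open>full_below\<close> allows them to be raised to a common one.\<close>
        define M where "M = Max (N ` ?L)"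
        have M: "N v \<le> M" if "v \<in> ?L" for v
          unfolding M_def using that finite_level by (intro Max_ge) auto
        have "vsec H (y @ x) = G" if "length x = length u + M" for x
        proof -
          define v where "v = take (length u) x"
          define x1 where "x1 = take (N v) (drop (length u) x)"
          define x2 where "x2 = drop (N v) (drop (length u) x)"
          have x: "y @ x = ((y @ v) @ x1) @ x2" by (simp add: v_def x1_def x2_def del: drop_drop)
          have v: "v \<in> ?L" using that by (simp add: v_def)
          then have "length x1 = N v" using that M[OF v] by (simp add: x1_def)
          then show ?thesis unfolding x by (intro full_below N v)
        qed
        then show ?thesis by blast
      qed
    next
      case False
      then obtain v where v: "length v = length u" "\<not> cost (y @ v) < cost y" by blast
      \<comment> \<open>The orbit of \<open>y @ v\<close> keeps the whole cost of \<open>y\<close>,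
        which leaves nothing for any other orbit of the level. The vertices \<open>y @ u\<close> and
        \<open>y @ u'\<close> cannot both be in the orbit of \<open>y @ v\<close>.\<close>
      have zero: "cost (y @ v') = 0" if "length v' = length u" "\<not> (\<exists>h\<in>H. h (y @ v) = y @ v')" for v'
        using cost_append[of v v' y] that v by auto
      have "\<not> (\<exists>h\<in>H. h (y @ v) = y @ u) \<or> \<not> (\<exists>h\<in>H. h (y @ v) = y @ u')"
      proof (rule ccontr)
        assume "\<not> ?thesis"
        then have "y @ u \<in> orb (y @ v)" "y @ u' \<in> orb (y @ v)" unfolding orb_def by force+
        then obtain h h' where h: "h \<in> H" "h' \<in> H" "y @ u = h (y @ v)" "y @ u' = h' (y @ v)"
          unfolding orb_def by auto
        then have "(h' \<circ> inv h) (y @ u) = y @ u'" using H_taut by simp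
        then show False using u(2) h taut_group_comp[OF group_H] taut_group_inv[OF group_H] by blast
      qed
      then have "cost (y @ u) = 0 \<or> cost (y @ u') = 0" using zero[of u] zero[of u'] u(1) by auto
      then show ?thesis using cost_0_finite by blast
    qed
  qed
qed

lemma alternative:
  "(\<exists>y. finite (psi y H)) \<or>
    (\<exists>Y. leaf_set Y \<and> spanning Y \<and> (\<forall>y\<in>Y. finite_index_subgroup (psi y (stab H Y)) G))"
proof (cases "\<exists>y. finite (psi y H)")
  case False
  then obtain N where N: "\<And>u. length u = N \<Longrightarrow> vsec H u = G"
    using sections_finite_or_full[of "[]"] by auto
  \<comment> \<open>A whole level is a spanning leaf set that \<open>H\<close> permutes.\<close>
  let ?Y = "{v :: 'b list. length v = N}"
  have "leaf_set ?Y" unfolding leaf_set_def using finite_level by (auto simp: prefix_def)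
  moreover have "spanning ?Y" unfolding spanning_def
  proof (intro exI[of _ N] allI impI)
    fix w :: "'b list" assume "N \<le> length w"
    then show "\<exists>y\<in>?Y. prefix y w" by (intro bexI[of _ "take N w"]) (simp_all add: take_is_prefix)
  qed
  moreover have "finite_index_subgroup (psi y (stab H ?Y)) G" if "y \<in> ?Y" for y
    using that N by (intro finite_index_psi_stab group_H finite_level) (auto simp: taut_length[OF H_taut])
  ultimately show ?thesis by blast
qed blast

end

theorem GN_alternative_G: "GN_alternative G"
  unfolding GN_alternative_def Let_def by (intro allI impI alternative) auto

end

section \<open>The Grigorchuk group\<close>

text \<open>The Klein four-group of \<open>b\<close>, \<open>c\<close>, \<open>d\<close> is written as \<open>bool \<times> bool\<close>: the first component
  tells whether the section at the letter 0 is \<open>a\<close>, and \<open>gr_rot\<close> is passing to the section at the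
  letter 1, that is \<open>b \<mapsto> c \<mapsto> d \<mapsto> b\<close>.\<close>

datatype gr_letter = LA | LB "bool \<times> bool"

definition gr_B :: "bool \<times> bool \<Rightarrow> bool list \<Rightarrow> bool list" where
  "gr_B s = (if fst s then (if snd s then gr_b else gr_c) else if snd s then gr_d else id)"

definition gr_rot :: "bool \<times> bool \<Rightarrow> bool \<times> bool" where
  "gr_rot s = (snd s, fst s \<noteq> snd s)"

definition gr_add :: "bool \<times> bool \<Rightarrow> bool \<times> bool \<Rightarrow> bool \<times> bool" where
  "gr_add s t = (fst s \<noteq> fst t, snd s \<noteq> snd t)"

fun gr_ev :: "gr_letter \<Rightarrow> bool list \<Rightarrow> bool list" where
  "gr_ev LA = gr_a" | "gr_ev (LB s) = gr_B s"

fun gr_act :: "gr_letter \<Rightarrow> bool \<Rightarrow> bool" where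
  "gr_act LA = Not" | "gr_act (LB s) = id"

fun gr_sec :: "gr_letter \<Rightarrow> bool \<Rightarrow> gr_letter list" where
  "gr_sec LA x = []"
| "gr_sec (LB s) x = (if x then [LB (gr_rot s)] else if fst s then [LA] else [])"

text \<open>The trivial letter \<open>LB (False, False)\<close> counts as well: its section at 1 is
  the same letter, so additivity holds uniformly.\<close>

fun gr_wt :: "gr_letter \<Rightarrow> nat" where
  "gr_wt LA = 0" | "gr_wt (LB s) = 1"

lemma gr_a_invol: "gr_a (gr_a v) = v"
  by (cases v) simp_all

lemma gr_B_Nil: "gr_B s [] = []"
  by (simp add: gr_B_def)

lemma gr_B_Cons: "gr_B s (x # v) = x # (if x then gr_B (gr_rot s) v else if fst s then gr_a v else v)"
  by (cases x) (auto simp: gr_B_def gr_rot_def)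

lemma gr_rot_add: "gr_rot (gr_add s t) = gr_add (gr_rot s) (gr_rot t)"
  by (auto simp: gr_rot_def gr_add_def)

lemma gr_B_add: "gr_B s (gr_B t v) = gr_B (gr_add s t) v"
proof (induction v arbitrary: s t)
  case Nil show ?case by (simp add: gr_B_Nil)
next
  case (Cons x v)
  then have "x \<Longrightarrow> ?case" by (simp add: gr_B_Cons gr_rot_add)
  moreover have "\<not> x \<Longrightarrow> ?case" by (auto simp: gr_B_Cons gr_a_invol gr_add_def)
  ultimately show ?case by blast
qed

lemma gr_add_self [simp]: "gr_add s s = (False, False)"
  by (simp add: gr_add_def)

lemma gr_add_cancel [simp]: "gr_add (gr_add t s) s = t" "gr_add s (gr_add t s) = t"
  by (cases t; cases s; auto simp: gr_add_def)+

lemma gr_B_0 [simp]: "gr_B (False, False) = id"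
  by (simp add: gr_B_def)

lemma gr_B_invol: "gr_B s (gr_B s v) = v"
  by (simp add: gr_B_add)

lemma gr_ev_invol: "gr_ev l \<circ> gr_ev l = id"
  by (cases l) (simp_all add: fun_eq_iff gr_a_invol gr_B_invol)

interpretation GR: word_group gr_ev gr_act gr_sec gr_wt
proof
  fix l :: gr_letter and x :: bool and v :: "bool list"
  show "gr_ev l [] = []" by (cases l) (simp_all add: gr_B_Nil)
  show "gr_ev l (x # v) = gr_act l x # weval gr_ev (gr_sec l x) v"
    by (cases l) (simp_all add: gr_B_Cons)
  show "\<exists>w. gr_ev l \<circ> weval gr_ev w = id \<and> weval gr_ev w \<circ> gr_ev l = id"
    using gr_ev_invol[of l] by (intro exI[of _ "[l]"]) (simp only: weval.simps comp_id simp_thms)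
  show "finite (UNIV :: bool set)" by simp
  show "(\<Sum>x\<in>UNIV. sum_list (map gr_wt (gr_sec l x))) = gr_wt l"
    by (cases l) (simp_all add: UNIV_bool)
qed

lemma gr_eval_B: "GR.eval [LB s] = gr_B s" and gr_eval_a: "GR.eval [LA] = gr_a"
  by simp_all

lemma gr_B_G: "gr_B s \<in> GR.G" and gr_a_G: "gr_a \<in> GR.G"
  unfolding gr_eval_B[symmetric] gr_eval_a[symmetric] by (rule rangeI)+

lemma taut_gr_B: "taut (gr_B s)"
  using GR.taut_eval[of "[LB s]"] by (simp only: gr_eval_B)

lemma inv_gr_B: "inv (gr_B s) = gr_B s"
  by (rule inv_unique_comp) (simp_all add: fun_eq_iff gr_B_invol)

lemma gr_G_least:
  assumes "gr_a \<in> K" "\<And>s. gr_B s \<in> K" "taut_group K" shows "GR.G \<subseteq> K"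
proof -
  have "GR.eval w \<in> K" for w
  proof (induction w)
    case Nil show ?case unfolding weval.simps by (rule taut_group_id[OF assms(3)])
  next
    case (Cons l w)
    have "gr_ev l \<in> K" using assms by (cases l) simp_all
    then show ?case unfolding weval.simps using Cons by (rule taut_group_comp[OF assms(3)])
  qed
  then show ?thesis by blast
qed

lemma grigorchuk_group_eq: "grigorchuk_group = GR.G"
proof
  have eq: "gr_b = gr_B (True, True)" "gr_c = gr_B (True, False)" "gr_d = gr_B (False, True)"
    by (simp_all add: gr_B_def)
  show "grigorchuk_group \<subseteq> GR.G"
    unfolding grigorchuk_group_def eq
    by (intro gen_grp_least GR.taut_group_G) (simp only: insert_subset empty_subsetI gr_B_G gr_a_G simp_thms)
  have sub: "{gr_a, gr_b, gr_c, gr_d} \<subseteq> grigorchuk_group"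
    unfolding grigorchuk_group_def using gen_grp_superset by (rule subsetI)
  have id: "id \<in> grigorchuk_group" unfolding grigorchuk_group_def by (rule gen_grp.gen_id)
  have "taut s" if "s \<in> {gr_a, gr_b, gr_c, gr_d}" for s
    using that taut_gr_B GR.taut_eval[of "[LA]"] unfolding eq gr_eval_a by blast
  then have "taut_group grigorchuk_group"
    unfolding grigorchuk_group_def by (rule taut_group_gen_grp)
  moreover have "gr_B s \<in> grigorchuk_group" for s
    using sub id unfolding gr_B_def by simp
  ultimately show "GR.G \<subseteq> grigorchuk_group" using sub by (intro gr_G_least) simp_all
qed

section \<open>Exponents of Grigorchuk words and of their sections\<close>

fun gr_eps_letter :: "gr_letter \<Rightarrow> bool" where
  "gr_eps_letter LA = True" | "gr_eps_letter (LB s) = False"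

fun gr_tau_letter :: "gr_letter \<Rightarrow> bool \<times> bool" where
  "gr_tau_letter LA = (False, False)" | "gr_tau_letter (LB s) = s"

primrec gr_eps :: "gr_letter list \<Rightarrow> bool" where
  "gr_eps [] = False" | "gr_eps (l # w) = (gr_eps_letter l \<noteq> gr_eps w)"

text \<open>The product of the Klein letters of a word: its class modulo commutators and
  \<open>a\<close>.\<close>

primrec gr_tau :: "gr_letter list \<Rightarrow> bool \<times> bool" where
  "gr_tau [] = (False, False)" | "gr_tau (l # w) = gr_add (gr_tau_letter l) (gr_tau w)"

lemma gr_eps_append [simp]: "gr_eps (u @ v) = (gr_eps u \<noteq> gr_eps v)"
  by (induction u) auto

lemma gr_tau_append [simp]: "gr_tau (u @ v) = gr_add (gr_tau u) (gr_tau v)"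
  by (induction u) (auto simp: gr_add_def)

lemma gr_act_eps: "GR.act w x = (x \<noteq> gr_eps w)"
proof (induction w)
  case (Cons l w) then show ?case by (cases l) auto
qed simp

text \<open>A Klein letter \<open>s\<close> read at 0 contributes \<open>fst s\<close> to the parity
  of this section and \<open>gr_rot s\<close> to the class of the opposite one, and
  \<open>fst s\<close> is the sum of the two components of \<open>gr_rot s\<close>. Read at 1 it
  contributes to neither side.\<close>

lemma gr_eps_sec:
  "gr_eps (GR.sec w x) = (fst (gr_tau (GR.sec w (\<not> x))) \<noteq> snd (gr_tau (GR.sec w (\<not> x))))"
proof (induction w)
  case (Cons l w) then show ?case
    by (cases l) (auto simp: gr_act_eps gr_add_def gr_rot_def)
qed simp

text \<open>Exactly one of the two sections reads a given Klein letter at 1, where it becomes its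
  rotation.\<close>

lemma gr_tau_sec: "gr_add (gr_tau (GR.sec w x)) (gr_tau (GR.sec w (\<not> x))) = gr_rot (gr_tau w)"
proof (induction w)
  case (Cons l w)
  then show ?case by (cases l) (auto simp: gr_act_eps gr_add_def gr_rot_def)
qed (simp add: gr_add_def gr_rot_def)

lemma gr_eps_sec_sum: "(gr_eps (GR.sec w x) \<noteq> gr_eps (GR.sec w (\<not> x))) = fst (gr_tau w)"
  using gr_eps_sec[of w x] gr_eps_sec[of w "\<not> x"] gr_tau_sec[of w x]
  by (auto simp: gr_add_def gr_rot_def)

lemma gr_weight_sec: "GR.weight (GR.sec w x) + GR.weight (GR.sec w (\<not> x)) = GR.weight w"
  using GR.weight_sec[of w] by (cases x) (simp_all add: UNIV_bool)

text \<open>All Klein letters of \<open>w\<close> are read at 1 along \<open>x\<close>. Hence they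
  are all conjugated by the same power of \<open>a\<close> and multiply to a single Klein
  element.\<close>

lemma gr_concentrated:
  assumes "GR.weight (GR.sec w (\<not> x)) = 0"
  shows "GR.eval w v = (if gr_eps w then gr_a else id)
    ((if x then id else gr_a) (gr_B (gr_tau w) ((if x then id else gr_a) v)))"
  using assms
proof (induction w)
  case Nil show ?case by (simp add: gr_a_invol)
next
  case (Cons l w)
  have IH: "GR.eval w v = (if gr_eps w then gr_a else id)
    ((if x then id else gr_a) (gr_B (gr_tau w) ((if x then id else gr_a) v)))"
    using Cons by simp
  show ?case
  proof (cases l)
    case LA then show ?thesis by (simp add: IH gr_a_invol gr_add_def)
  next
    case (LB s)
    have "GR.act w (\<not> x) = False" using Cons.prems LB by (auto split: if_splits)
    then have "gr_eps w = (\<not> x)" by (auto simp: gr_act_eps)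
    then show ?thesis by (simp add: LB IH gr_a_invol gr_B_add)
  qed
qed

lemma gr_eval_rev: "GR.eval (rev w) = inv (GR.eval w)"
proof -
  have "GR.eval (rev w) (GR.eval w v) = v" for w v
    using gr_ev_invol by (induction w arbitrary: v) (simp_all add: weval_append fun_eq_iff)
  from this[of w] this[of "rev w"] show ?thesis
    by (intro inv_unique_comp[symmetric]) (simp_all add: fun_eq_iff)
qed

lemma gr_tau_rev: "gr_tau (rev w) = gr_tau w"
  by (induction w) (auto simp: gr_add_def)

text \<open>Since \<open>w\<close> swaps the two letters, each section of \<open>w @ w\<close> is
  the product of both sections of \<open>w\<close>, so classes, parities and weights add up.\<close>

lemma gr_square_sec:
  assumes "gr_eps w"
  shows "GR.act (w @ w) x = x" "gr_tau (GR.sec (w @ w) x) = gr_rot (gr_tau w)"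
    "gr_eps (GR.sec (w @ w) x) = fst (gr_tau w)" "GR.weight (GR.sec (w @ w) x) = GR.weight w"
proof -
  have sec: "GR.sec (w @ w) x = GR.sec w (\<not> x) @ GR.sec w x"
    using assms by (simp add: wsec_append gr_act_eps)
  show "GR.act (w @ w) x = x" using assms by (simp add: gr_act_eps)
  show "gr_tau (GR.sec (w @ w) x) = gr_rot (gr_tau w)"
    using gr_tau_sec[of w "\<not> x"] unfolding sec by simp
  show "gr_eps (GR.sec (w @ w) x) = fst (gr_tau w)"
    using gr_eps_sec_sum[of w x] unfolding sec by auto
  show "GR.weight (GR.sec (w @ w) x) = GR.weight w"
    using gr_weight_sec[of w x] unfolding sec by simp
qed


section \<open>Alternating words\<close>

primrec gr_alt :: "(bool \<times> bool) list \<Rightarrow> gr_letter list" where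
  "gr_alt [] = []" | "gr_alt (s # ss) = LA # LB s # gr_alt ss"

primrec gr_count_a :: "gr_letter list \<Rightarrow> nat" where
  "gr_count_a [] = 0" | "gr_count_a (l # w) = (if l = LA then 1 else 0) + gr_count_a w"

lemma gr_alt_append [simp]: "gr_alt (ss @ ts) = gr_alt ss @ gr_alt ts"
  by (induction ss) simp_all

lemma gr_count_a_append [simp]: "gr_count_a (u @ v) = gr_count_a u + gr_count_a v"
  by (induction u) simp_all

lemma gr_eps_count_a: "gr_eps w = odd (gr_count_a w)"
proof (induction w)
  case (Cons l w) then show ?case by (cases l) auto
qed simp

lemma gr_count_a_alt: "gr_count_a (gr_alt ss) = length ss"
  by (induction ss) simp_all

text \<open>Adjacent Klein letters are multiplied, and trivial ones are put between adjacent letters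
  \<open>LA\<close>; this keeps the number of letters \<open>LA\<close> and the class.\<close>

lemma gr_normal_form:
  "\<exists>s ss. length ss = gr_count_a w \<and> GR.eval w = gr_B s \<circ> GR.eval (gr_alt ss)
    \<and> gr_tau w = gr_add s (gr_tau (gr_alt ss))"
proof (induction w)
  case Nil
  have "GR.eval [] = gr_B (False, False) \<circ> GR.eval (gr_alt [])" by simp
  then show ?case by (intro exI[of _ "(False, False)"] exI[of _ "[]"]) (simp add: gr_add_def)
next
  case (Cons l w)
  then obtain s ss where IH: "length ss = gr_count_a w" "GR.eval w = gr_B s \<circ> GR.eval (gr_alt ss)"
    "gr_tau w = gr_add s (gr_tau (gr_alt ss))" by blast
  show ?case
  proof (cases l)
    case LA
    have "GR.eval (l # w) = gr_B (False, False) \<circ> GR.eval (gr_alt (s # ss))"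
      by (simp add: LA IH(2) comp_assoc)
    moreover have "length (s # ss) = gr_count_a (l # w)" "gr_tau (l # w) = gr_add (False, False) (gr_tau (gr_alt (s # ss)))"
      by (simp_all add: LA IH gr_add_def)
    ultimately show ?thesis by blast
  next
    case (LB t)
    have "GR.eval (l # w) = gr_B (gr_add t s) \<circ> GR.eval (gr_alt ss)"
      by (simp add: LB IH(2) fun_eq_iff gr_B_add)
    moreover have "length ss = gr_count_a (l # w)" "gr_tau (l # w) = gr_add (gr_add t s) (gr_tau (gr_alt ss))"
      by (auto simp add: LB IH gr_add_def)
    ultimately show ?thesis by blast
  qed
qed

text \<open>The initial Klein factor is moved to the end by conjugation, where it merges with the
  last letter.\<close>

lemma gr_normal_form_conj:
  assumes "0 < gr_count_a w"
  shows "\<exists>s ss. length ss = gr_count_a w \<and> GR.eval w = gr_B s \<circ> GR.eval (gr_alt ss) \<circ> gr_B s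
    \<and> gr_tau w = gr_tau (gr_alt ss)"
proof -
  obtain s ss where ss: "length ss = gr_count_a w" "GR.eval w = gr_B s \<circ> GR.eval (gr_alt ss)"
    "gr_tau w = gr_add s (gr_tau (gr_alt ss))" using gr_normal_form by blast
  then have "ss \<noteq> []" using assms by auto
  then obtain ts t where ts: "ss = ts @ [t]" by (metis append_butlast_last_id)
  let ?us = "ts @ [gr_add t s]"
  have "length ?us = gr_count_a w" using ss(1) ts by simp
  moreover have "GR.eval w = gr_B s \<circ> GR.eval (gr_alt ?us) \<circ> gr_B s"
    by (simp add: ss(2) ts weval_append fun_eq_iff gr_B_add)
  moreover have "gr_tau w = gr_tau (gr_alt ?us)"
    by (auto simp: ss(3) ts gr_add_def)
  ultimately show ?thesis by blast
qed

text \<open>Linear independence over the field with two elements, as nonvanishing of the determinant.\<close>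

definition gr_indep :: "bool \<times> bool \<Rightarrow> bool \<times> bool \<Rightarrow> bool" where
  "gr_indep s t \<longleftrightarrow> (fst s \<and> snd t) \<noteq> (snd s \<and> fst t)"

lemma gr_indep_rot: "gr_indep (gr_rot s) (gr_rot t) = gr_indep s t"
  by (auto simp: gr_indep_def gr_rot_def)

text \<open>The data kept through the descent. Independence makes \<open>s\<close> and the class of
  \<open>w\<close> generate the Klein group.\<close>

definition gr_good :: "(bool list \<Rightarrow> bool list) set \<Rightarrow> bool \<times> bool \<Rightarrow> gr_letter list \<Rightarrow> bool" where
  "gr_good L s w \<longleftrightarrow> taut_group L \<and> L \<subseteq> GR.G \<and> gr_B s \<in> L \<and> GR.eval w \<in> L \<and> gr_eps w
    \<and> gr_indep s (gr_tau w)"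

section \<open>Full sections from an odd word and a Klein element\<close>

lemma gr_B_vsec:
  assumes "gr_B s \<in> L" shows "gr_B (gr_rot s) \<in> vsec L [True]"
  using GR.vsec_eval[of "[LB s]" L True] assms by simp

fun gr_count_fst :: "(bool \<times> bool) list \<Rightarrow> nat" where
  "gr_count_fst [] = 0" | "gr_count_fst (s # ss) = (if fst s then 1 else 0) + gr_count_fst ss"

lemma gr_count_fst_le: "gr_count_fst ss \<le> length ss"
  by (induction ss) auto

lemma gr_count_fst_less: "s \<in> set ss \<Longrightarrow> \<not> fst s \<Longrightarrow> gr_count_fst ss < length ss"
proof (induction ss)
  case (Cons t ss) then show ?case using gr_count_fst_le[of ss] by auto
qed simp

text \<open>The two sections together read each letter once at 0, and there it yields an
  \<open>a\<close> exactly if its first component holds.\<close>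

lemma gr_count_a_sec_alt:
  "gr_count_a (GR.sec (gr_alt ss) x) + gr_count_a (GR.sec (gr_alt ss) (\<not> x)) = gr_count_fst ss"
  by (induction ss) (auto simp: gr_act_eps)

text \<open>The letters are read alternately at 0 and at 1, so a section alternates between
  \<open>LA\<close> and rotated letters. The section at 0 starts with a rotated letter and ends with
  \<open>LA\<close>, which the extra \<open>LA\<close> on both sides accounts for.\<close>

lemma gr_sec_alt:
  assumes "even (length ss)" "\<forall>s\<in>set ss. fst s"
  shows "\<exists>es os. GR.sec (gr_alt ss) True = gr_alt es \<and> LA # GR.sec (gr_alt ss) False = gr_alt os @ [LA]
    \<and> set es \<union> set os = gr_rot ` set ss \<and> length es + length os = length ss"
  using assms
proof (induction ss rule: induct_list012)
  case 1 show ?case by (intro exI[of _ "[]"]) simp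
next
  case (3 s t ss)
  then obtain es os where IH: "GR.sec (gr_alt ss) True = gr_alt es" "LA # GR.sec (gr_alt ss) False = gr_alt os @ [LA]"
    "set es \<union> set os = gr_rot ` set ss" "length es + length os = length ss" by auto
  have ev: "\<not> gr_eps (gr_alt ss)" using 3 by (simp add: gr_eps_count_a gr_count_a_alt)
  have "GR.sec (gr_alt (s # t # ss)) True = gr_alt (gr_rot t # es)"
    using 3 ev IH(1) by (simp add: gr_act_eps)
  moreover have "LA # GR.sec (gr_alt (s # t # ss)) False = gr_alt (gr_rot s # os) @ [LA]"
    using 3 ev IH(2) by (simp add: gr_act_eps)
  moreover have "set (gr_rot t # es) \<union> set (gr_rot s # os) = gr_rot ` set (s # t # ss)"
    using IH(3) by auto
  moreover have "length (gr_rot t # es) + length (gr_rot s # os) = length (s # t # ss)"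
    using IH(4) by simp
  ultimately show ?case by blast
qed simp

text \<open>The word is \<open>w = a s\<^sub>1 \<dots> a s\<^sub>k a t\<close>, and the section in question is that of \<open>w x w\<close> at the letter 1,
  where \<open>x \<in> {1, s}\<close> is chosen such that this section again moves the first letter. Each \<open>s\<^sub>i\<close> is read
  once at the letter 0, where it contributes at most one \<open>a\<close>, and none if it is \<open>d\<close>. Hence the section
  is shorter than \<open>w\<close>, unless no \<open>s\<^sub>i\<close> is \<open>d\<close>; then its inner letters are the rotated \<open>s\<^sub>i\<close>.\<close>

lemma gr_descend:
  assumes "gr_good L s (gr_alt (ss @ [t]))"
  shows "(\<exists>w. gr_good (vsec L [True]) (gr_rot s) w \<and> gr_count_a w \<le> length ss)
    \<or> (\<forall>u\<in>set ss. fst u) \<and> (\<exists>ss'. gr_good (vsec L [True]) (gr_rot s) (gr_alt (ss' @ [gr_rot t]))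
      \<and> length ss' = length ss \<and> set ss' = gr_rot ` set ss)"
proof -
  let ?c = "gr_alt ss" and ?w = "gr_alt (ss @ [t])"
  note g = assms[unfolded gr_good_def]
  define x where "x = (if fst (gr_tau ?w) then (False, False) else s)"
  have xL: "gr_B x \<in> L" using g taut_group_id[of L] by (auto simp: x_def)
  \<comment> \<open>If the class of \<open>?w\<close> has first component false, independence forces
    \<open>fst s\<close>.\<close>
  have fx: "fst x = (\<not> fst (gr_tau ?w))" using g by (auto simp: x_def gr_indep_def)
  have ev: "\<not> gr_eps ?c" and evl: "even (length ss)"
    using g by (auto simp: gr_eps_count_a gr_count_a_alt)
  define m where "m = (if fst (gr_add t x) then [LA] else [])"
  \<comment> \<open>Read from the right at the letter 1: \<open>t\<close> is rotated,
    \<open>LA\<close> leads to 0, the even word \<open>?c\<close> and the merged middle letter are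
    read there, and the next \<open>LA\<close> leads back to 1 for the second
    \<open>?c\<close>.\<close>
  define V where "V = GR.sec ?c True @ m @ GR.sec ?c False @ [LB (gr_rot t)]"
  let ?W = "?c @ [LA, LB (gr_add t x)] @ ?c @ [LA, LB t]"
  have "GR.eval ?W = GR.eval ?w \<circ> gr_B x \<circ> GR.eval ?w"
    by (simp add: weval_append fun_eq_iff gr_B_add)
  then have "GR.eval ?W \<in> L" using g xL by (simp only: taut_group_comp)
  moreover have "GR.act ?W True = True" using ev by (simp add: gr_act_eps)
  ultimately have "GR.eval (GR.sec ?W True) \<in> vsec L [True]" by (rule GR.vsec_eval)
  also have "GR.sec ?W True = V"
    using ev by (simp add: V_def m_def wsec_append weval_append gr_act_eps)
  finally have VL: "GR.eval V \<in> vsec L [True]" .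
  have tauV: "gr_tau V = gr_rot (gr_tau ?w)"
    using gr_tau_sec[of ?c True] by (auto simp: V_def m_def gr_add_def gr_rot_def)
  have epsV: "gr_eps V"
    using gr_eps_sec_sum[of ?c True] fx by (auto simp: V_def m_def gr_add_def)
  have good: "gr_good (vsec L [True]) (gr_rot s) V"
    unfolding gr_good_def tauV gr_indep_rot
    using g VL epsV gr_B_vsec[of s L] taut_group_vsec[of L "[True]"] GR.vsec_subset_G[of L "[True]"] by blast
  have count: "gr_count_a V = gr_count_fst ss + gr_count_a m"
    using gr_count_a_sec_alt[of ss True] by (simp add: V_def)
  show ?thesis
  proof (cases "\<forall>u\<in>set ss. fst u")
    case False
    then obtain u where "u \<in> set ss" "\<not> fst u" by blast
    then have "gr_count_a V \<le> length ss"
      using gr_count_fst_less[of u ss] by (simp add: count m_def)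
    then show ?thesis using good by blast
  next
    case True
    show ?thesis
    proof (cases "m = [LA]")
      case False
      then have "gr_count_a V \<le> length ss" using gr_count_fst_le[of ss] by (auto simp: count m_def)
      then show ?thesis using good by blast
    next
      case m: True
      obtain es os where eo: "GR.sec ?c True = gr_alt es" "LA # GR.sec ?c False = gr_alt os @ [LA]"
        "set es \<union> set os = gr_rot ` set ss" "length es + length os = length ss"
        using gr_sec_alt[OF evl True] by blast
      have "V = gr_alt ((es @ os) @ [gr_rot t])" using eo(1,2) by (simp add: V_def m)
      moreover have "length (es @ os) = length ss" "set (es @ os) = gr_rot ` set ss"
        using eo(3,4) by simp_all
      ultimately show ?thesis using good True by metis
    qed
  qed
qed

text \<open>If \<open>fst s\<close>, the sections of \<open>w x w\<close> at 1 for trivial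
  \<open>x\<close> and for \<open>x = s\<close> differ exactly by a factor \<open>a\<close>. This
  yields \<open>a\<close> and the rotated \<open>t\<close>, and with the rotated \<open>s\<close>
  all generators. Otherwise one descent makes \<open>fst s\<close> true.\<close>

lemma gr_good_single:
  assumes "gr_good L s (gr_alt [t])" shows "GR.has_full_section L"
proof -
  have *: "GR.has_full_section L" if good: "gr_good L s (gr_alt [t])" and fs: "fst s" for L s t
  proof -
    note g = good[unfolded gr_good_def]
    let ?M = "vsec L [True]"
    have L: "taut_group L" and M: "taut_group ?M" using g taut_group_vsec by blast+
    have sec: "GR.eval (m @ [LB (gr_rot t)]) \<in> ?M"
      if x: "gr_B x \<in> L" and m: "m = (if fst x \<noteq> fst t then [LA] else [])" for x m
    proof -
      let ?W = "gr_alt [t] @ [LB x] @ gr_alt [t]"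
      have "GR.eval ?W \<in> L" using g x unfolding weval_append gr_eval_B by (blast intro: taut_group_comp)
      moreover have "GR.act ?W True = True" by simp
      ultimately have "GR.eval (GR.sec ?W True) \<in> ?M" by (rule GR.vsec_eval)
      moreover have "GR.eval (GR.sec ?W True) = GR.eval (m @ [LB (gr_rot t)])"
        using gr_a_invol by (auto simp: m fun_eq_iff)
      ultimately show ?thesis by simp
    qed
    have t: "gr_B (gr_rot t) \<in> ?M" and at: "gr_a \<circ> gr_B (gr_rot t) \<in> ?M"
    proof -
      have "gr_B (False, False) \<in> L" using taut_group_id[OF L] by simp
      from sec[OF this refl] sec[of s, OF _ refl] g fs
      show "gr_B (gr_rot t) \<in> ?M" "gr_a \<circ> gr_B (gr_rot t) \<in> ?M" by (cases "fst t"; simp)+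
    qed
    have "gr_a \<circ> gr_B (gr_rot t) \<circ> gr_B (gr_rot t) \<in> ?M" by (rule taut_group_comp[OF M at t])
    moreover have "gr_a \<circ> gr_B (gr_rot t) \<circ> gr_B (gr_rot t) = gr_a" by (simp add: fun_eq_iff gr_B_invol)
    ultimately have a: "gr_a \<in> ?M" by simp
    have s: "gr_B (gr_rot s) \<in> ?M" using g gr_B_vsec by blast
    have ind: "gr_indep (gr_rot s) (gr_rot t)" using g by (simp add: gr_indep_rot gr_add_def)
    have st: "gr_B (gr_add (gr_rot s) (gr_rot t)) \<in> ?M"
      using taut_group_comp[OF M s t] by (simp add: comp_def gr_B_add)
    have "gr_B u \<in> ?M" for u
    proof -
      have "u = (False, False) \<or> u = gr_rot s \<or> u = gr_rot t \<or> u = gr_add (gr_rot s) (gr_rot t)"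
        using ind unfolding gr_indep_def gr_add_def by (cases u; cases "gr_rot s"; cases "gr_rot t") auto
      then show ?thesis using s t st taut_group_id[OF M] by auto
    qed
    then have "?M = GR.G" using gr_G_least[OF a _ M] GR.vsec_subset_G g by blast
    then have "GR.has_full_section ?M" by (rule GR.has_full_section_G[OF M])
    then show ?thesis by (rule GR.has_full_section_vsec[OF L])
  qed
  show ?thesis
  proof (cases "fst s")
    case True then show ?thesis using * assms by blast
  next
    case False
    have L: "taut_group L" using assms by (simp add: gr_good_def)
    have fs: "fst (gr_rot s)" using False assms by (auto simp: gr_good_def gr_indep_def gr_rot_def)
    have "\<not> gr_good (vsec L [True]) (gr_rot s) w" if "gr_count_a w \<le> 0" for w
      using that by (auto simp: gr_good_def gr_eps_count_a)
    then have "gr_good (vsec L [True]) (gr_rot s) (gr_alt [gr_rot t])"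
      using gr_descend[of L s "[]" t] assms by auto
    then have "GR.has_full_section (vsec L [True])" using fs by (rule *)
    then show ?thesis by (rule GR.has_full_section_vsec[OF L])
  qed
qed

text \<open>Induction on the number of letters \<open>LA\<close>, after a conjugation that makes the
  word alternating; the conjugator fixes \<open>gr_B s\<close> because the Klein group is
  commutative.\<close>

lemma gr_good_full: "gr_good L s w \<Longrightarrow> GR.has_full_section L"
proof (induction "gr_count_a w" arbitrary: L s w rule: less_induct)
  case less
  note g = less.prems[unfolded gr_good_def]
  have "0 < gr_count_a w" using g by (auto simp: gr_eps_count_a intro: Nat.gr0I)
  then obtain r rs where r: "length rs = gr_count_a w" "GR.eval w = gr_B r \<circ> GR.eval (gr_alt rs) \<circ> gr_B r"
    "gr_tau w = gr_tau (gr_alt rs)" using gr_normal_form_conj by blast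
  let ?K = "conj_by (gr_B r) L"
  have L: "taut_group L" using g by blast
  have K: "taut_group ?K" by (rule taut_group_conj_by[OF L taut_gr_B])
  have down: "GR.has_full_section (vsec M [True]) \<Longrightarrow> GR.has_full_section M"
    if "gr_good M s' w'" for M s' w'
    using that GR.has_full_section_vsec by (auto simp: gr_good_def)
  have "gr_B r \<circ> gr_B s \<circ> inv (gr_B r) = gr_B s"
    by (simp add: inv_gr_B fun_eq_iff gr_B_add)
  then have sK: "gr_B s \<in> ?K" using conj_byI[of "gr_B s" L "gr_B r"] g by simp
  have "gr_B r \<circ> GR.eval w \<circ> inv (gr_B r) = GR.eval (gr_alt rs)"
    by (simp add: r(2) inv_gr_B fun_eq_iff gr_B_invol)
  then have wK: "GR.eval (gr_alt rs) \<in> ?K" using conj_byI[of "GR.eval w" L "gr_B r"] g by simp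
  have "gr_eps (gr_alt rs)" using g r(1) by (simp add: gr_eps_count_a gr_count_a_alt)
  then have good: "gr_good ?K s (gr_alt rs)"
    using K sK wK g r(3) GR.conj_by_subset_G[OF _ gr_B_G] by (simp add: gr_good_def)
  obtain ss t where rs: "rs = ss @ [t]"
    using \<open>0 < gr_count_a w\<close> r(1) by (metis append_butlast_last_id length_0_conv less_nat_zero_code)
  then have len: "length ss < gr_count_a w" using r(1) by simp
  have "GR.has_full_section ?K"
  proof (rule ccontr)
    assume no: "\<not> GR.has_full_section ?K"
    \<comment> \<open>A shorter good word would give a full section by induction, so only the second
      outcome of \<open>gr_descend\<close> remains; it can be repeated, as the length is
      kept.\<close>
    have step: "(\<forall>u\<in>set us. fst u) \<and> (\<exists>us'. gr_good (vsec M [True]) (gr_rot s') (gr_alt (us' @ [gr_rot t']))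
        \<and> length us' = length us \<and> set us' = gr_rot ` set us \<and> \<not> GR.has_full_section (vsec M [True]))"
      if M: "gr_good M s' (gr_alt (us @ [t']))" "length us = length ss" "\<not> GR.has_full_section M" for M s' us t'
    proof -
      have nM: "\<not> GR.has_full_section (vsec M [True])" using down M by blast
      have "\<not> (\<exists>w. gr_good (vsec M [True]) (gr_rot s') w \<and> gr_count_a w \<le> length us)"
        using less.hyps nM len M(2) by (metis le_less_trans)
      then show ?thesis using gr_descend[OF M(1)] nM by blast
    qed
    from step[OF good[unfolded rs] refl no] obtain us1 where
      1: "\<forall>u\<in>set ss. fst u" "gr_good (vsec ?K [True]) (gr_rot s) (gr_alt (us1 @ [gr_rot t]))"
        "length us1 = length ss" "set us1 = gr_rot ` set ss" "\<not> GR.has_full_section (vsec ?K [True])" by blast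
    from step[OF 1(2,3,5)] obtain us2 where
      2: "\<forall>u\<in>set us1. fst u" "gr_good (vsec (vsec ?K [True]) [True]) (gr_rot (gr_rot s)) (gr_alt (us2 @ [gr_rot (gr_rot t)]))"
        "length us2 = length us1" "set us2 = gr_rot ` set us1" "\<not> GR.has_full_section (vsec (vsec ?K [True]) [True])" by blast
    have "\<forall>u\<in>set us2. fst u" using step[OF 2(2) _ 2(5)] 2(3) 1(3) by simp
    then have rot: "fst u" "fst (gr_rot u)" "fst (gr_rot (gr_rot u))" if "u \<in> set ss" for u
      using 1(1) 2(1) that unfolding 2(4) 1(4) by blast+
    \<comment> \<open>No Klein element keeps its first component true through two rotations.\<close>
    have "ss = []"
    proof (rule ccontr)
      assume "ss \<noteq> []"
      then have "hd ss \<in> set ss" by simp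
      from rot[OF this] show False by (simp add: gr_rot_def)
    qed
    then show False using gr_good_single good rs no by auto
  qed
  then show ?case by (rule GR.has_full_section_conj_by[OF L gr_B_G])
qed


text \<open>The section of \<open>d\<close> at 1 is \<open>b\<close>, so an odd word in
  \<open>?L\<close> whose class has unequal components suffices. Transitivity gives an odd word
  \<open>z\<close> in \<open>?L\<close>, and the opposite section \<open>?v\<close> has such a class
  by \<open>gr_eps_sec\<close>. Conjugated into \<open>?L\<close> as \<open>?u\<close>, either it,
  or \<open>z\<close>, or their product is as wanted.\<close>

lemma gr_full_if_d:
  assumes K: "taut_group K" and KG: "K \<subseteq> GR.G" and trans: "level_transitive K"
    and d: "gr_B (False, True) \<in> K"
  shows "GR.has_full_section K"
proof -
  let ?L = "vsec K [True]"
  have L: "taut_group ?L" by (rule taut_group_vsec[OF K])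
  obtain f where f: "f \<in> ?L" "f [True] = [False]"
    using level_transitiveD[OF level_transitive_vsec[OF K trans, of "[True]"], of "[True]" "[False]"] by auto
  then obtain h where h: "h \<in> K" "h [True] = [True]" "f = sect h [True]" unfolding mem_vsec by blast
  then obtain w where w: "h = GR.eval w" using KG by blast
  have ev: "\<not> gr_eps w" using h(2) unfolding w by (simp add: GR.eval_Cons gr_act_eps)
  define z where "z = GR.sec w True"
  have zL: "GR.eval z \<in> ?L" using f(1) h(3) by (simp add: w z_def GR.sect_eval)
  have ez: "gr_eps z" using f(2) by (simp add: h(3) w z_def GR.sect_eval GR.eval_Cons gr_act_eps)
  let ?v = "GR.sec w False"
  have tv: "fst (gr_tau ?v) \<noteq> snd (gr_tau ?v)" using gr_eps_sec[of w True] ez by (simp add: z_def)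
  have vK: "GR.eval ?v \<in> vsec K [False]"
    using h(1) ev unfolding w by (intro GR.vsec_eval) (simp_all add: gr_act_eps)
  obtain k where k: "k \<in> K" "k [False] = [True]"
    using level_transitiveD[OF trans, of "[False]" "[True]"] by auto
  then obtain y where y: "sect k [False] = GR.eval y" using GR.sect_G KG by blast
  let ?u = "y @ ?v @ rev y"
  have "GR.eval ?u = GR.eval y \<circ> GR.eval ?v \<circ> inv (GR.eval y)"
    by (simp only: weval_append gr_eval_rev comp_assoc)
  then have uL: "GR.eval ?u \<in> ?L"
    using vsec_orbit[OF K k(1), of "[False]"] conj_byI[OF vK, of "GR.eval y"] by (simp add: k(2) y)
  have tu: "gr_tau ?u = gr_tau ?v" by (simp add: gr_tau_rev)
  have "\<exists>x. GR.eval x \<in> ?L \<and> gr_eps x \<and> fst (gr_tau x) \<noteq> snd (gr_tau x)"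
  proof -
    consider "gr_eps ?u" | "fst (gr_tau z) \<noteq> snd (gr_tau z)"
      | "\<not> gr_eps ?u" "fst (gr_tau z) = snd (gr_tau z)" by blast
    then show ?thesis
    proof cases
      case 1 then show ?thesis using uL tu tv by metis
    next
      case 2 then show ?thesis using zL ez by blast
    next
      case 3
      have "GR.eval (z @ ?u) \<in> ?L" unfolding weval_append[of _ z] by (rule taut_group_comp[OF L zL uL])
      moreover have "gr_eps (z @ ?u)" using 3 ez by simp
      moreover have "fst (gr_tau (z @ ?u)) \<noteq> snd (gr_tau (z @ ?u))"
        unfolding gr_tau_append[of z] tu using 3 tv by (auto simp: gr_add_def)
      ultimately show ?thesis by blast
    qed
  qed
  then obtain x where x: "GR.eval x \<in> ?L" "gr_eps x" "fst (gr_tau x) \<noteq> snd (gr_tau x)" by blast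
  moreover have "gr_B (True, True) \<in> ?L" using gr_B_vsec[OF d] by (simp add: gr_rot_def)
  ultimately have "gr_good ?L (True, True) x"
    using L GR.vsec_subset_G[OF KG] by (simp add: gr_good_def gr_indep_def)
  then show ?thesis using gr_good_full GR.has_full_section_vsec[OF K] by blast
qed

text \<open>Sections at 1 lead from \<open>b\<close> to \<open>c\<close> and from \<open>c\<close>
  to \<open>d\<close>.\<close>

lemma gr_full_if_B:
  assumes "taut_group K" "K \<subseteq> GR.G" "level_transitive K" "gr_B s \<in> K" "s \<noteq> (False, False)"
  shows "GR.has_full_section K"
proof -
  have rot: "GR.has_full_section M" if M: "taut_group M" "M \<subseteq> GR.G" "level_transitive M" "gr_B u \<in> M"
    and full: "\<And>M. taut_group M \<Longrightarrow> M \<subseteq> GR.G \<Longrightarrow> level_transitive M \<Longrightarrow> gr_B (gr_rot u) \<in> M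
      \<Longrightarrow> GR.has_full_section M" for M u
    by (rule GR.has_full_section_vsec[OF M(1), of "[True]"], rule full)
      (use M in \<open>simp_all add: taut_group_vsec GR.vsec_subset_G level_transitive_vsec gr_B_vsec\<close>)
  have c: "GR.has_full_section M" if "taut_group M" "M \<subseteq> GR.G" "level_transitive M" "gr_B (True, False) \<in> M" for M
    by (rule rot[OF that]) (simp add: gr_rot_def gr_full_if_d)
  have b: "GR.has_full_section M" if "taut_group M" "M \<subseteq> GR.G" "level_transitive M" "gr_B (True, True) \<in> M" for M
    by (rule rot[OF that]) (simp add: gr_rot_def c)
  consider "s = (True, True)" | "s = (True, False)" | "s = (False, True)" using assms(5) by (cases s) auto
  then show ?thesis using assms b c gr_full_if_d by cases auto
qed

lemma gr_level_transitive_full: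
  assumes H: "taut_group H" and HG: "H \<subseteq> GR.G" and trans: "level_transitive H"
  shows "\<exists>y. vsec H y = GR.G"
proof -
  let ?P = "\<lambda>(y, w). GR.eval w \<in> vsec H y \<and> gr_tau w \<noteq> (False, False)"
  have VG: "taut_group (vsec H y)" for y by (rule taut_group_vsec[OF H])
  have "\<exists>p. ?P p"
  proof -
    obtain f where f: "f \<in> vsec H [True]" "f [True] = [False]"
      using level_transitiveD[OF level_transitive_vsec[OF H trans, of "[True]"], of "[True]" "[False]"] by auto
    then obtain h where h: "h \<in> H" "h [True] = [True]" "f = sect h [True]" unfolding mem_vsec by blast
    then obtain w where w: "h = GR.eval w" using HG by blast
    have ev: "\<not> gr_eps w" using h(2) unfolding w by (simp add: GR.eval_Cons gr_act_eps)
    have "gr_eps (GR.sec w True)" using f(2) by (simp add: h(3) w GR.sect_eval GR.eval_Cons gr_act_eps)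
    then have "gr_tau (GR.sec w False) \<noteq> (False, False)" using gr_eps_sec[of w True] by auto
    moreover have "GR.eval (GR.sec w False) \<in> vsec H [False]"
      using h(1) ev unfolding w by (intro GR.vsec_eval) (simp_all add: gr_act_eps)
    ultimately show ?thesis by blast
  qed
  \<comment> \<open>The minimum is taken over pairs, hence over all vertices at once: passing to a
    section cannot give a lighter word of nontrivial class.\<close>
  then obtain p where p: "?P p" "\<And>q. ?P q \<Longrightarrow> GR.weight (snd p) \<le> GR.weight (snd q)"
    using ex_has_least_nat[of ?P _ "\<lambda>q. GR.weight (snd q)"] by blast
  define least where "least y w \<longleftrightarrow> GR.eval w \<in> vsec H y \<and> gr_tau w \<noteq> (False, False)
    \<and> (\<forall>y' w'. GR.eval w' \<in> vsec H y' \<longrightarrow> gr_tau w' \<noteq> (False, False) \<longrightarrow> GR.weight w \<le> GR.weight w')" for y w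
  have least0: "least (fst p) (snd p)"
    using p(1) p(2)[of "(_, _)"] unfolding least_def by (simp add: case_prod_unfold)
  have square: "least (y @ [True]) (GR.sec (w @ w) True)" if lw: "least y w" and e: "gr_eps w" for y w
  proof -
    note c = gr_square_sec[OF e, of True]
    have "GR.eval w \<in> vsec H y" using lw by (simp add: least_def)
    then have "GR.eval (w @ w) \<in> vsec H y" unfolding weval_append by (intro taut_group_comp[OF VG])
    then have "GR.eval (GR.sec (w @ w) True) \<in> vsec (vsec H y) [True]" using c(1) by (rule GR.vsec_eval)
    moreover have "gr_rot (gr_tau w) \<noteq> (False, False)"
      using lw by (cases "gr_tau w") (auto simp: least_def gr_rot_def)
    ultimately show ?thesis using lw c(2,4) by (simp add: least_def vsec_append[OF H])
  qed
  \<comment> \<open>If all least words were odd, then so would be the sections of their squares,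
    whose parity is the first component of the class. As squaring rotates the class, that component
    would stay true through two rotations.\<close>
  have "\<exists>y w. least y w \<and> \<not> gr_eps w"
  proof (rule ccontr)
    assume no: "\<not> ?thesis"
    have nxt: "\<exists>y' w'. least y' w' \<and> gr_tau w' = gr_rot (gr_tau w) \<and> fst (gr_tau w)" if lw: "least y w" for y w
    proof -
      have e: "gr_eps w" using no lw by blast
      have "gr_eps (GR.sec (w @ w) True)" using no square[OF lw e] by blast
      then show ?thesis using square[OF lw e] gr_square_sec[OF e, of True] by auto
    qed
    obtain y1 w1 where 1: "least y1 w1" "gr_tau w1 = gr_rot (gr_tau (snd p))" "fst (gr_tau (snd p))"
      using nxt[OF least0] by blast
    obtain y2 w2 where 2: "least y2 w2" "gr_tau w2 = gr_rot (gr_tau w1)" "fst (gr_tau w1)"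
      using nxt[OF 1(1)] by blast
    have "fst (gr_tau w2)" using nxt[OF 2(1)] by blast
    then show False using 1 2 by (auto simp: gr_rot_def)
  qed
  then obtain y w where lw: "least y w" and ev: "\<not> gr_eps w" by blast
  have "\<exists>x. gr_tau (GR.sec w x) \<noteq> (False, False)"
  proof (rule ccontr)
    assume "\<not> ?thesis"
    then have "gr_rot (gr_tau w) = (False, False)" using gr_tau_sec[of w True] by (simp add: gr_add_def)
    then show False using lw by (cases "gr_tau w") (auto simp: least_def gr_rot_def)
  qed
  then obtain x where x: "gr_tau (GR.sec w x) \<noteq> (False, False)" by blast
  let ?V = "vsec H y"
  have wV: "GR.eval w \<in> ?V" using lw by (simp add: least_def)
  then have "GR.eval (GR.sec w x) \<in> vsec ?V [x]" using ev by (intro GR.vsec_eval) (simp_all add: gr_act_eps)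
  then have "GR.eval (GR.sec w x) \<in> vsec H (y @ [x])" by (simp only: vsec_append[OF H])
  \<comment> \<open>By minimality the section with nontrivial class carries the whole weight, so
    \<open>gr_concentrated\<close> applies at the other letter.\<close>
  then have "GR.weight w \<le> GR.weight (GR.sec w x)" using lw x unfolding least_def by blast
  then have "GR.weight (GR.sec w (\<not> x)) = 0" using gr_weight_sec[of w x] by linarith
  from gr_concentrated[OF this] ev
  have val: "GR.eval w v = (if x then id else gr_a) (gr_B (gr_tau w) ((if x then id else gr_a) v))" for v
    by simp
  define c where "c = (if x then id else gr_a)"
  have cc: "c (c v) = v" for v by (simp add: c_def gr_a_invol)
  have cG: "c \<in> GR.G" using gr_a_G taut_group_id[OF GR.taut_group_G] by (simp add: c_def)
  have tc: "taut c" by (rule taut_group_taut[OF GR.taut_group_G cG])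
  have ic: "inv c = c" by (rule inv_unique_comp) (simp_all add: fun_eq_iff cc)
  have "c \<circ> GR.eval w \<circ> inv c = gr_B (gr_tau w)"
    unfolding ic by (simp add: fun_eq_iff val c_def[symmetric] cc)
  then have "gr_B (gr_tau w) \<in> conj_by c ?V" using conj_byI[OF wV, of c] by simp
  moreover have "gr_tau w \<noteq> (False, False)" using lw by (simp add: least_def)
  ultimately have "GR.has_full_section (conj_by c ?V)"
    using gr_full_if_B[OF taut_group_conj_by[OF VG tc] GR.conj_by_subset_G[OF GR.vsec_subset_G[OF HG] cG]
        level_transitive_conj_by[OF level_transitive_vsec[OF H trans] tc]] by blast
  then have "GR.has_full_section ?V" by (rule GR.has_full_section_conj_by[OF VG cG])
  then have "GR.has_full_section H" by (rule GR.has_full_section_vsec[OF H])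
  then show ?thesis unfolding GR.has_full_section_def .
qed

lemma gr_weight_0: "GR.weight w = 0 \<Longrightarrow> GR.eval w = id \<or> GR.eval w = gr_a"
proof (induction w)
  case (Cons l w)
  then have "l = LA" by (cases l) simp_all
  moreover have "GR.weight w = 0" using Cons.prems by simp
  then have "GR.eval w = id \<or> GR.eval w = gr_a" by (rule Cons.IH)
  moreover have "gr_a \<circ> gr_a = id" by (simp add: fun_eq_iff gr_a_invol)
  ultimately show ?case
    unfolding weval.simps by (elim disjE) (simp_all only: gr_ev.simps comp_id simp_thms)
qed simp

theorem GN_alternative_grigorchuk: "GN_alternative grigorchuk_group"
proof -
  have "GN_group gr_ev gr_act gr_sec gr_wt"
  proof
    have "GR.eval ` {w. GR.weight w = 0} \<subseteq> {id, gr_a}" using gr_weight_0 by blast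
    then show "finite (GR.eval ` {w. GR.weight w = 0})" by (rule finite_subset) simp
  next
    fix w assume "GR.weight w = 0"
    then have "GR.weight (rev w) = 0" by (simp add: rev_map[symmetric])
    then show "\<exists>w'. GR.weight w' = 0 \<and> inv (GR.eval w) = GR.eval w'" using gr_eval_rev[of w]
      by (intro exI[of _ "rev w"]) (simp only: simp_thms)
  next
    fix g x assume g: "g \<in> GR.G"
    have word: "GR.eval (GR.sec w x) \<in> vsec GR.G [x]" if "\<not> gr_eps w" for w
      by (rule GR.vsec_eval) (use that in \<open>simp_all add: gr_act_eps\<close>)
    let ?c = "if x then [] else [LA]" and ?a = "if x then [LA] else []"
    have a: "gr_a \<in> vsec GR.G [x]"
      using word[of "?a @ [LB (True, True)] @ ?a"] by (simp split: if_splits)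
    have "gr_B s \<in> vsec GR.G [x]" for s
    proof -
      \<comment> \<open>\<open>gr_rot\<close> is invertible, so every Klein element is the section
        of another one.\<close>
      have "s = gr_rot (fst s \<noteq> snd s, fst s)" by (cases s) (auto simp: gr_rot_def)
      then obtain t where "s = gr_rot t" by blast
      then show ?thesis using word[of "?c @ [LB t] @ ?c"] by (simp split: if_splits)
    qed
    then show "g \<in> vsec GR.G [x]" using gr_G_least[OF a _ taut_group_vsec[OF GR.taut_group_G]] g by blast
  next
    fix H assume "taut_group H" "H \<subseteq> GR.G" "level_transitive H"
    then show "\<exists>y. vsec H y = GR.G" by (rule gr_level_transitive_full)
  qed
  from GN_group.GN_alternative_G[OF this] show ?thesis by (simp only: grigorchuk_group_eq)
qed

section \<open>The Gupta--Sidki group\<close>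

text \<open>\<open>SU\<close> is the square, hence the inverse, of \<open>t\<close>. As a letter of
  weight 1 it lets inversion of words keep the weight.\<close>

datatype gs_letter = SA | ST | SU

fun gs_ev :: "gs_letter \<Rightarrow> tri list \<Rightarrow> tri list" where
  "gs_ev SA = gs_a" | "gs_ev ST = gs_t" | "gs_ev SU = gs_t \<circ> gs_t"

fun gs_act :: "gs_letter \<Rightarrow> tri \<Rightarrow> tri" where
  "gs_act SA = tri_succ" | "gs_act ST = id" | "gs_act SU = id"

fun gs_sec :: "gs_letter \<Rightarrow> tri \<Rightarrow> gs_letter list" where
  "gs_sec SA _ = []"
| "gs_sec ST X0 = [SA]" | "gs_sec ST X1 = [SA, SA]" | "gs_sec ST X2 = [ST]"
| "gs_sec SU X0 = [SA, SA]" | "gs_sec SU X1 = [SA]" | "gs_sec SU X2 = [SU]"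

fun gs_wt :: "gs_letter \<Rightarrow> nat" where
  "gs_wt SA = 0" | "gs_wt ST = 1" | "gs_wt SU = 1"

lemma UNIV_tri: "(UNIV :: tri set) = {X0, X1, X2}"
  using tri.nchotomy by auto

lemma tri_succ_succ [simp]: "tri_succ (tri_succ x) = tri_pred x"
  and tri_pred_pred [simp]: "tri_pred (tri_pred x) = tri_succ x"
  and tri_succ_pred [simp]: "tri_succ (tri_pred x) = x"
  and tri_pred_succ [simp]: "tri_pred (tri_succ x) = x"
  by (cases x; simp)+

lemma gs_a_inv_eq: "gs_a_inv v = gs_a (gs_a v)"
  by (cases v) simp_all

lemma gs_a_cube: "gs_a (gs_a (gs_a v)) = v"
  by (cases v) simp_all

lemma gs_t_cube: "gs_t (gs_t (gs_t v)) = v"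
proof (induction v)
  case (Cons x v) then show ?case by (cases x) (simp_all add: gs_a_inv_eq gs_a_cube)
qed simp

interpretation GS: word_group gs_ev gs_act gs_sec gs_wt
proof
  fix l :: gs_letter and x :: tri and v :: "tri list"
  show "gs_ev l [] = []" by (cases l) simp_all
  show "gs_ev l (x # v) = gs_act l x # weval gs_ev (gs_sec l x) v"
    by (cases l; cases x) (simp_all add: gs_a_inv_eq gs_a_cube)
  show "\<exists>w. gs_ev l \<circ> weval gs_ev w = id \<and> weval gs_ev w \<circ> gs_ev l = id"
  proof (cases l)
    case SA then show ?thesis by (intro exI[of _ "[SA, SA]"]) (simp add: fun_eq_iff gs_a_cube)
  next
    case ST then show ?thesis by (intro exI[of _ "[SU]"]) (simp add: fun_eq_iff gs_t_cube)
  next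
    case SU then show ?thesis by (intro exI[of _ "[ST]"]) (simp add: fun_eq_iff gs_t_cube)
  qed
  show "finite (UNIV :: tri set)" by (simp add: UNIV_tri)
  show "(\<Sum>x\<in>UNIV. sum_list (map gs_wt (gs_sec l x))) = gs_wt l"
    by (cases l) (simp_all add: UNIV_tri)
qed

lemma gs_a_G: "gs_a \<in> GS.G" and gs_t_G: "gs_t \<in> GS.G"
  by (rule range_eqI[of _ _ "[SA]"], simp) (rule range_eqI[of _ _ "[ST]"], simp)

lemma gupta_sidki_group_eq: "gupta_sidki_group = GS.G"
proof
  show "gupta_sidki_group \<subseteq> GS.G"
    unfolding gupta_sidki_group_def using gs_a_G gs_t_G
    by (intro gen_grp_least GS.taut_group_G) (simp only: insert_subset empty_subsetI simp_thms)
  have l: "gs_ev l \<in> gupta_sidki_group" for l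
  proof -
    have "gs_a \<in> gupta_sidki_group" "gs_t \<in> gupta_sidki_group"
      unfolding gupta_sidki_group_def by (auto intro: gen_grp_superset)
    then show ?thesis by (cases l) (simp_all add: gupta_sidki_group_def gen_grp_comp)
  qed
  have "GS.eval w \<in> gupta_sidki_group" for w
  proof (induction w)
    case Nil show ?case unfolding gupta_sidki_group_def weval.simps by (rule gen_grp.gen_id)
  next
    case (Cons x w) then show ?case
      using l[of x] unfolding gupta_sidki_group_def weval.simps by (intro gen_grp_comp)
  qed
  then show "GS.G \<subseteq> gupta_sidki_group" by blast
qed

section \<open>Exponents of Gupta--Sidki words and of their sections\<close>

fun gs_tau_letter :: "gs_letter \<Rightarrow> int" where
  "gs_tau_letter SA = 0" | "gs_tau_letter ST = 1" | "gs_tau_letter SU = - 1"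

fun gs_eps_letter :: "gs_letter \<Rightarrow> nat" where
  "gs_eps_letter SA = 1" | "gs_eps_letter ST = 0" | "gs_eps_letter SU = 0"

definition gs_tau :: "gs_letter list \<Rightarrow> int" where "gs_tau w = sum_list (map gs_tau_letter w)"
definition gs_eps :: "gs_letter list \<Rightarrow> nat" where "gs_eps w = sum_list (map gs_eps_letter w)"

lemma gs_tau_simps [simp]: "gs_tau [] = 0" "gs_tau (l # w) = gs_tau_letter l + gs_tau w"
    "gs_tau (u @ v) = gs_tau u + gs_tau v"
  and gs_eps_simps [simp]: "gs_eps [] = 0" "gs_eps (l # w) = gs_eps_letter l + gs_eps w"
    "gs_eps (u @ v) = gs_eps u + gs_eps v"
  by (simp_all add: gs_tau_def gs_eps_def)

lemma gs_act_succ: "GS.act w (tri_succ x) = tri_succ (GS.act w x)"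
proof (induction w)
  case (Cons l w) then show ?case by (cases l) simp_all
qed simp

lemma gs_act_pred: "GS.act w (tri_pred x) = tri_pred (GS.act w x)"
  using gs_act_succ[of w "tri_succ x"] gs_act_succ[of w x] by simp

lemma gs_act_eps:
  "GS.act w x = (if gs_eps w mod 3 = 0 then x else if gs_eps w mod 3 = 1 then tri_succ x else tri_pred x)"
proof (induction w)
  case (Cons l w) then show ?case by (cases l) (auto simp: mod_Suc)
qed simp

lemma gs_act_fixed: "GS.act w x = x \<longleftrightarrow> 3 dvd gs_eps w"
  by (cases x) (auto simp: gs_act_eps dvd_eq_mod_eq_0)

text \<open>Modulo 3, a letter \<open>t\<close> gives \<open>a\<close> to the section that reads it
  at \<open>X0\<close> and the inverse of \<open>a\<close> to the one at \<open>X1\<close>, while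
  the section at \<open>X2\<close> keeps \<open>t\<close>. Seen from the first that section is the
  predecessor, from the second the successor.\<close>

lemma gs_eps_sec:
  "3 dvd (int (gs_eps (GS.sec w x)) - gs_tau (GS.sec w (tri_pred x)) + gs_tau (GS.sec w (tri_succ x)))"
proof (induction w)
  case (Cons l w)
  define y where "y = GS.act w x"
  have "3 dvd (int (gs_eps (gs_sec l y)) - gs_tau (gs_sec l (tri_pred y)) + gs_tau (gs_sec l (tri_succ y)))"
    by (cases l; cases y) simp_all
  from dvd_add[OF this Cons] show ?case
    by (simp add: gs_act_succ gs_act_pred y_def algebra_simps)
qed simp

lemma gs_tau_sec: "gs_tau (GS.sec w x) + gs_tau (GS.sec w (tri_succ x)) + gs_tau (GS.sec w (tri_pred x)) = gs_tau w"
proof (induction w)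
  case (Cons l w)
  define y where "y = GS.act w x"
  have "gs_tau (gs_sec l y) + gs_tau (gs_sec l (tri_succ y)) + gs_tau (gs_sec l (tri_pred y)) = gs_tau_letter l"
    by (cases l; cases y) simp_all
  with Cons show ?case by (simp add: gs_act_succ gs_act_pred y_def)
qed simp

lemma gs_weight_sec:
  "GS.weight (GS.sec w x) + GS.weight (GS.sec w (tri_succ x)) + GS.weight (GS.sec w (tri_pred x)) = GS.weight w"
  using GS.weight_sec[of w] by (cases x) (simp_all add: UNIV_tri)

text \<open>The conjugate of \<open>t\<close> by the power of \<open>a\<close> that moves the letter \<open>x\<close> to the
  letter \<open>X2\<close>, below which \<open>t\<close> acts recursively.\<close>

fun gs_conj_word :: "tri \<Rightarrow> gs_letter list" where
  "gs_conj_word X0 = [SA, ST, SA, SA]" | "gs_conj_word X1 = [SA, SA, ST, SA]" | "gs_conj_word X2 = [ST]"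

lemma funpow_mod_3:
  assumes "\<And>v. f (f (f v)) = v" shows "f ^^ m = f ^^ (m mod 3)"
proof
  fix v
  have "(f ^^ 3) v = v" by (simp add: numeral_3_eq_3 assms)
  then show "(f ^^ m) v = (f ^^ (m mod 3)) v" by (rule funpow_mod_eq[symmetric])
qed

lemmas gs_a_power = funpow_mod_3[OF gs_a_cube]

lemma gs_t_a_power:
  assumes "GS.act w x = X2"
  shows "gs_t \<circ> gs_a ^^ gs_eps w = gs_a ^^ gs_eps w \<circ> GS.eval (gs_conj_word x)"
proof -
  have "gs_eps w mod 3 = 0 \<or> gs_eps w mod 3 = 1 \<or> gs_eps w mod 3 = 2" by linarith
  then show ?thesis using assms unfolding gs_a_power[of "gs_eps w"]
    by (cases x; elim disjE) (simp_all add: gs_act_eps fun_eq_iff gs_a_cube numeral_2_eq_2)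
qed

text \<open>Every letter other than \<open>SA\<close> is read at \<open>X2\<close> along
  \<open>x\<close>, so moving it past the powers of \<open>a\<close> always produces the same
  conjugate of \<open>t\<close>.\<close>

lemma gs_concentrated:
  assumes "GS.weight (GS.sec w (tri_succ x)) = 0" "GS.weight (GS.sec w (tri_pred x)) = 0"
  shows "\<exists>n. GS.eval w = gs_a ^^ gs_eps w \<circ> GS.eval (gs_conj_word x) ^^ n \<and> 3 dvd (int n - gs_tau w)"
  using assms
proof (induction w)
  case Nil show ?case by (intro exI[of _ 0]) simp
next
  case (Cons l w)
  let ?C = "GS.eval (gs_conj_word x)"
  have "GS.weight (GS.sec w (tri_succ x)) = 0" "GS.weight (GS.sec w (tri_pred x)) = 0"
    using Cons.prems by simp_all
  from Cons.IH[OF this]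
  obtain n where n: "GS.eval w = gs_a ^^ gs_eps w \<circ> ?C ^^ n" "3 dvd (int n - gs_tau w)"
    by blast
  show ?case
  proof (cases "l = SA")
    case True
    then have "GS.eval (l # w) = gs_a ^^ gs_eps (l # w) \<circ> ?C ^^ n" "gs_tau (l # w) = gs_tau w"
      using n(1) by (simp_all add: comp_assoc)
    then show ?thesis using n(2) by auto
  next
    case False
    have "GS.act w (tri_succ x) \<noteq> X2" "GS.act w (tri_pred x) \<noteq> X2"
      using Cons.prems False by (cases l; auto)+
    then have X2: "GS.act w x = X2" unfolding gs_act_succ gs_act_pred by (cases "GS.act w x") auto
    have t: "gs_t \<circ> (gs_a ^^ gs_eps w \<circ> f) = gs_a ^^ gs_eps w \<circ> (?C \<circ> f)" for f
      using gs_t_a_power[OF X2] by (metis comp_assoc)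
    show ?thesis
    proof (cases l)
      case ST
      then have "GS.eval (l # w) = gs_a ^^ gs_eps (l # w) \<circ> ?C ^^ Suc n" using t n(1) by simp
      moreover have "3 dvd (int (Suc n) - gs_tau (l # w))" using n(2) ST by simp
      ultimately show ?thesis by blast
    next
      case SU
      have "GS.eval (l # w) = gs_t \<circ> (gs_t \<circ> (gs_a ^^ gs_eps w \<circ> ?C ^^ n))"
        by (simp add: SU n(1) comp_assoc)
      also have "\<dots> = gs_a ^^ gs_eps w \<circ> (?C \<circ> (?C \<circ> ?C ^^ n))" by (simp only: t)
      also have "\<dots> = gs_a ^^ gs_eps (l # w) \<circ> ?C ^^ Suc (Suc n)" by (simp add: SU)
      finally have "GS.eval (l # w) = gs_a ^^ gs_eps (l # w) \<circ> ?C ^^ Suc (Suc n)" .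
      \<comment> \<open>\<open>SU\<close> adds 2 to \<open>n\<close> but \<open>-1\<close> to the
        exponent sum, which agrees modulo 3.\<close>
      moreover have "int (Suc (Suc n)) - gs_tau (l # w) = (int n - gs_tau w) + 3" using SU by simp
      ultimately show ?thesis using n(2) by (metis dvd_add dvd_refl)
    qed (use False in simp)
  qed
qed

section \<open>Inverse words\<close>

fun gs_inv_letter :: "gs_letter \<Rightarrow> gs_letter list" where
  "gs_inv_letter SA = [SA, SA]" | "gs_inv_letter ST = [SU]" | "gs_inv_letter SU = [ST]"

primrec gs_inv_word :: "gs_letter list \<Rightarrow> gs_letter list" where
  "gs_inv_word [] = []" | "gs_inv_word (l # w) = gs_inv_word w @ gs_inv_letter l"

lemma gs_weight_inv_word: "GS.weight (gs_inv_word w) = GS.weight w"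
proof (induction w)
  case (Cons l w) then show ?case by (cases l) simp_all
qed simp

lemma gs_eval_inv_letter: "GS.eval (gs_inv_letter l) = inv (gs_ev l)"
proof -
  have "gs_ev l \<circ> GS.eval (gs_inv_letter l) = id" "GS.eval (gs_inv_letter l) \<circ> gs_ev l = id"
    by (cases l; simp add: fun_eq_iff gs_a_cube gs_t_cube)+
  then show ?thesis using inv_unique_comp by metis
qed

lemma gs_eval_inv_word: "GS.eval (gs_inv_word w) = inv (GS.eval w)"
proof (induction w)
  case (Cons l w)
  have "bij (gs_ev l)" "bij (GS.eval w)" using taut_bij[OF GS.taut_eval] taut_bij[OF GS.taut_eval[of "[l]"]] by auto
  then have "inv (gs_ev l \<circ> GS.eval w) = inv (GS.eval w) \<circ> inv (gs_ev l)" by (rule o_inv_distrib)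
  then show ?case
    by (simp only: gs_inv_word.simps weval.simps weval_append Cons gs_eval_inv_letter)
qed simp


section \<open>Full sections in the Gupta--Sidki group\<close>

lemma gs_G_least: "gs_a \<in> K \<Longrightarrow> gs_t \<in> K \<Longrightarrow> taut_group K \<Longrightarrow> GS.G \<subseteq> K"
  unfolding gupta_sidki_group_eq[symmetric] gupta_sidki_group_def
  by (rule gen_grp_least) (simp_all only: insert_subset empty_subsetI simp_thms)

text \<open>The sections of \<open>a\<close> at the letters are trivial, so the vertex groups on the
  first level are equal and not merely conjugate.\<close>

lemma gs_vsec_eq:
  assumes K: "taut_group K" and a: "gs_a \<in> K" shows "vsec K [x] = vsec K [X0]"
proof -
  have "vsec K [tri_succ y] = vsec K [y]" for y
  proof -
    have "sect gs_a [y] = id" using GS.sect_eval[of "[SA]" y] by simp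
    then have "vsec K (gs_a [y]) = conj_by id (vsec K [y])" using vsec_orbit[OF K a, of "[y]"] by simp
    then show ?thesis by (simp add: conj_by_def)
  qed
  from this[of X0] this[of X1] show ?thesis by (cases x) simp_all
qed

text \<open>Because \<open>a\<close> is in \<open>K\<close>, the sections of the conjugate of
  \<open>t\<close> all lie in the one group \<open>?L\<close>: conjugates of \<open>a\<close>, of
  its inverse and of \<open>t\<close> by the sections \<open>U X0\<close>, \<open>U X1\<close>,
  \<open>U X2\<close>. Undoing one of the first two conjugations gives the same situation with a new
  conjugator built from only two of the three sections.\<close>

lemma gs_full_if_conjugate:
  assumes "taut_group K" "K \<subseteq> GS.G" "gs_a \<in> K" "GS.eval u \<circ> gs_t \<circ> inv (GS.eval u) \<in> K"
  shows "GS.has_full_section K"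
  using assms
proof (induction "GS.weight u" arbitrary: u K rule: less_induct)
  case less
  note K = less.prems(1) and KG = less.prems(2) and a = less.prems(3) and g = less.prems(4)
  let ?g = "GS.eval u \<circ> gs_t \<circ> inv (GS.eval u)"
  let ?L = "vsec K [X0]"
  define U where "U x = GS.eval (GS.sec u x)" for x
  have tU: "taut (U x)" "U x \<in> GS.G" for x unfolding U_def by (simp_all add: GS.taut_eval)
  have tt: "taut gs_t" using GS.taut_eval[of "[ST]"] by simp
  have L: "taut_group ?L" by (rule taut_group_vsec[OF K])
  have sec: "U x \<circ> sect gs_t [x] \<circ> inv (U x) \<in> ?L" for x
  proof -
    have fx: "gs_t [x] = [x]" by (cases x) simp_all
    have ux: "GS.eval u [x] = [GS.act u x]" by (simp add: GS.eval_Cons GS.eval_Nil)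
    have "?g [GS.act u x] = [GS.act u x]"
      unfolding ux[symmetric] using taut_inv_f[OF GS.taut_eval, of u "[x]"] fx by simp
    then have "sect ?g [GS.act u x] \<in> vsec K [GS.act u x]" by (rule vsecI[OF g])
    moreover have "sect ?g [GS.act u x] = U x \<circ> sect gs_t [x] \<circ> inv (U x)"
      using sect_conj[OF GS.taut_eval tt fx, of u] by (simp add: ux U_def GS.sect_eval)
    ultimately show ?thesis by (simp only: gs_vsec_eq[OF K a, of "GS.act u x"])
  qed
  have t0: "sect gs_t [X0] = gs_a" and t1: "sect gs_t [X1] = inv gs_a" and t2: "sect gs_t [X2] = gs_t"
    using GS.sect_eval[of "[ST]"] gs_eval_inv_letter[of SA] by simp_all
  have step: "GS.has_full_section K"
    if al: "\<alpha> = gs_a \<or> \<alpha> = inv gs_a" and x: "U x \<circ> \<alpha> \<circ> inv (U x) \<in> ?L"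
      and w: "GS.weight (GS.sec u x) + GS.weight (GS.sec u X2) < GS.weight u" for \<alpha> x
  proof -
    let ?L' = "conj_by (inv (U x)) ?L"
    let ?u = "gs_inv_word (GS.sec u x) @ GS.sec u X2"
    have iU: "inv (U x) \<in> GS.G" "taut (inv (U x))"
      using tU taut_inv taut_group_inv[OF GS.taut_group_G] by blast+
    have L': "taut_group ?L'" by (rule taut_group_conj_by[OF L iU(2)])
    have "\<alpha> \<in> ?L'" using conj_byI[OF x, of "inv (U x)"] conj_cancel[OF tU(1)] by simp
    then have "gs_a \<in> ?L'"
      using al taut_group_inv[OF L', of \<alpha>] taut_bij[OF GS.taut_eval[of "[SA]"]] by (auto simp: inv_inv_eq)
    moreover have "GS.eval ?u \<circ> gs_t \<circ> inv (GS.eval ?u) \<in> ?L'"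
    proof -
      have eu: "GS.eval ?u = inv (U x) \<circ> U X2"
        by (simp only: weval_append gs_eval_inv_word U_def)
      have "inv (GS.eval ?u) = inv (U X2) \<circ> inv (inv (U x))"
        unfolding eu by (rule o_inv_distrib) (use tU(1) iU(2) taut_bij in blast)+
      then have "GS.eval ?u \<circ> gs_t \<circ> inv (GS.eval ?u) =
          inv (U x) \<circ> (U X2 \<circ> gs_t \<circ> inv (U X2)) \<circ> inv (inv (U x))"
        by (simp only: eu comp_assoc)
      then show ?thesis using conj_byI[OF sec[of X2], of "inv (U x)"] by (simp only: t2)
    qed
    moreover have "GS.weight ?u < GS.weight u" using w by (simp add: gs_weight_inv_word)
    ultimately have "GS.has_full_section ?L'"
      using less.hyps[of ?u ?L'] L' GS.conj_by_subset_G[OF GS.vsec_subset_G[OF KG] iU(1)] by blast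
    then have "GS.has_full_section ?L" by (rule GS.has_full_section_conj_by[OF L iU(1)])
    then show ?thesis by (rule GS.has_full_section_vsec[OF K])
  qed
  have sum: "GS.weight (GS.sec u X2) + GS.weight (GS.sec u X0) + GS.weight (GS.sec u X1) = GS.weight u"
    using gs_weight_sec[of u X2] by simp
  \<comment> \<open>The new conjugator is lighter as soon as the section left out has positive
    weight; if neither \<open>X0\<close> nor \<open>X1\<close> can be left out, \<open>u\<close> is
    concentrated at \<open>X2\<close>.\<close>
  consider "GS.weight (GS.sec u X1) > 0" | "GS.weight (GS.sec u X0) > 0"
    | "GS.weight (GS.sec u X0) = 0" "GS.weight (GS.sec u X1) = 0" by fastforce
  then show ?case
  proof cases
    case 1
    then show ?thesis using step[of gs_a X0] sec[of X0] sum t0 by simp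
  next
    case 2
    then show ?thesis using step[of "inv gs_a" X1] sec[of X1] sum t1 by simp
  next
    case 3
    then obtain n where n: "GS.eval u = gs_a ^^ gs_eps u \<circ> gs_t ^^ n"
      using gs_concentrated[of u X2] by auto
    define A where "A = gs_a ^^ gs_eps u"
    have "gs_a ^^ m \<in> K" for m
    proof (induction m)
      case 0 show ?case unfolding funpow.simps by (rule taut_group_id[OF K])
    next
      case (Suc m) then show ?case unfolding funpow.simps by (rule taut_group_comp[OF K a])
    qed
    then have "A \<in> K" unfolding A_def .
    then have tA: "taut A" using K taut_group_taut by blast
    \<comment> \<open>Powers of \<open>t\<close> commute with \<open>t\<close>, so only the power
      \<open>A\<close> of \<open>a\<close> matters, and \<open>A\<close> is in
      \<open>K\<close>.\<close>
    have eq: "GS.eval u \<circ> gs_t = A \<circ> gs_t \<circ> inv A \<circ> GS.eval u"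
      using tA unfolding n A_def[symmetric] by (simp add: fun_eq_iff funpow_swap1)
    have "?g = A \<circ> gs_t \<circ> inv A"
      unfolding eq using taut_f_inv[OF GS.taut_eval[of u]] by (simp add: fun_eq_iff)
    then have "inv A \<circ> ?g \<circ> A = gs_t" using tA by (simp add: fun_eq_iff)
    moreover have "inv A \<circ> ?g \<circ> A \<in> K"
      by (intro taut_group_comp[OF K] taut_group_inv[OF K] g \<open>A \<in> K\<close>)
    ultimately have "gs_t \<in> K" by (simp only:)
    then have "K = GS.G" using gs_G_least[OF a _ K] KG by blast
    then show ?thesis by (rule GS.has_full_section_G[OF K])
  qed
qed

text \<open>\<open>w\<close> permutes the three letters cyclically, so a section of its cube is the
  product of all three sections of \<open>w\<close>.\<close>

lemma gs_cube_sec: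
  assumes "\<not> 3 dvd gs_eps w"
  shows "GS.act (w @ w @ w) x = x" "gs_tau (GS.sec (w @ w @ w) x) = gs_tau w"
    "GS.weight (GS.sec (w @ w @ w) x) = GS.weight w" "3 dvd gs_eps (GS.sec (w @ w @ w) x)"
proof -
  have sec: "GS.sec (w @ w @ w) x = GS.sec w (GS.act w (GS.act w x)) @ GS.sec w (GS.act w x) @ GS.sec w x"
    by (simp add: wsec_append weval_append)
  have cyc: "GS.act w x = tri_succ x \<and> GS.act w (GS.act w x) = tri_pred x
      \<or> GS.act w x = tri_pred x \<and> GS.act w (GS.act w x) = tri_succ x"
    using assms by (auto simp: gs_act_eps dvd_eq_mod_eq_0)
  show "GS.act (w @ w @ w) x = x"
    using cyc by (auto simp: weval_append gs_act_succ gs_act_pred)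
  show "gs_tau (GS.sec (w @ w @ w) x) = gs_tau w"
    using cyc gs_tau_sec[of w x] unfolding sec by auto
  show "GS.weight (GS.sec (w @ w @ w) x) = GS.weight w"
    using cyc gs_weight_sec[of w x] unfolding sec by auto
  \<comment> \<open>Summed over the three letters, the congruences of \<open>gs_eps_sec\<close> lose
    all their \<open>gs_tau\<close> terms.\<close>
  have "3 dvd (int (gs_eps (GS.sec w x)) + int (gs_eps (GS.sec w (tri_succ x))) + int (gs_eps (GS.sec w (tri_pred x))))"
    using dvd_add[OF dvd_add[OF gs_eps_sec[of w x] gs_eps_sec[of w "tri_succ x"]] gs_eps_sec[of w "tri_pred x"]]
    by (simp add: algebra_simps)
  then have "3 dvd (gs_eps (GS.sec w x) + gs_eps (GS.sec w (tri_succ x)) + gs_eps (GS.sec w (tri_pred x)))"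
    by (metis int_dvd_int_iff of_nat_add of_nat_numeral)
  then show "3 dvd gs_eps (GS.sec (w @ w @ w) x)"
    using cyc unfolding sec by (auto simp: add_ac)
qed

lemma gs_conj_word_sections:
  "GS.act (gs_conj_word x) y = y" "GS.eval (GS.sec (gs_conj_word x) x) = gs_t"
  "GS.eval (GS.sec (gs_conj_word x) (tri_succ x)) = gs_a"
  "GS.eval (gs_conj_word x) \<circ> GS.eval (gs_conj_word x) \<circ> GS.eval (gs_conj_word x) = id"
  by (cases x; cases y; simp add: fun_eq_iff gs_a_cube gs_t_cube)+

lemma gs_level_transitive_full:
  assumes H: "taut_group H" and HG: "H \<subseteq> GS.G" and trans: "level_transitive H"
  shows "\<exists>y. vsec H y = GS.G"
proof -
  let ?P = "\<lambda>(y, w). GS.eval w \<in> vsec H y \<and> \<not> 3 dvd gs_tau w"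
  have VG: "taut_group (vsec H y)" for y by (rule taut_group_vsec[OF H])
  have "\<exists>p. ?P p"
  proof -
    obtain f where f: "f \<in> vsec H [X0]" "f [X0] = [X1]"
      using level_transitiveD[OF level_transitive_vsec[OF H trans, of "[X0]"], of "[X0]" "[X1]"] by auto
    then obtain h where h: "h \<in> H" "h [X0] = [X0]" "f = sect h [X0]" unfolding mem_vsec by blast
    then obtain w where w: "h = GS.eval w" using HG by blast
    have eps: "3 dvd gs_eps w" using h(2) unfolding w by (simp add: GS.eval_Cons gs_act_fixed)
    have "GS.act (GS.sec w X0) X0 \<noteq> X0"
      using f(2) unfolding h(3) w by (simp add: GS.sect_eval GS.eval_Cons)
    then have "\<not> 3 dvd gs_eps (GS.sec w X0)" using gs_act_fixed by blast
    then have "\<not> (3 dvd gs_tau (GS.sec w X2) \<and> 3 dvd gs_tau (GS.sec w X1))"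
      using gs_eps_sec[of w X0] by (auto simp: dvd_def) presburger
    then obtain x where "\<not> 3 dvd gs_tau (GS.sec w x)" by blast
    moreover have "GS.eval (GS.sec w x) \<in> vsec H [x]"
      using h(1) eps unfolding w by (intro GS.vsec_eval) (simp_all add: gs_act_fixed)
    ultimately show ?thesis by blast
  qed
  then obtain p where p: "?P p" "\<And>q. ?P q \<Longrightarrow> GS.weight (snd p) \<le> GS.weight (snd q)"
    using ex_has_least_nat[of ?P _ "\<lambda>q. GS.weight (snd q)"] by blast
  \<comment> \<open>If the least word moves the first letter, a section of its cube replaces it:
    weight and exponent sum are the same, and the new word fixes the first level.\<close>
  obtain y w where yw: "GS.eval w \<in> vsec H y" "\<not> 3 dvd gs_tau w" "3 dvd gs_eps w"
    and least: "\<And>y' w'. GS.eval w' \<in> vsec H y' \<Longrightarrow> \<not> 3 dvd gs_tau w' \<Longrightarrow> GS.weight w \<le> GS.weight w'"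
  proof (cases "3 dvd gs_eps (snd p)")
    case True
    show ?thesis by (rule that[of "snd p" "fst p"]) (use p True in \<open>force simp: case_prod_unfold\<close>)+
  next
    case False
    let ?w = "snd p" and ?y = "fst p"
    let ?w3 = "GS.sec (?w @ ?w @ ?w) X0"
    note c = gs_cube_sec[OF False, of X0]
    have "GS.eval ?w \<in> vsec H ?y" using p(1) by (simp add: case_prod_unfold)
    then have "GS.eval (?w @ ?w @ ?w) \<in> vsec H ?y"
      unfolding weval_append by (intro taut_group_comp[OF VG])
    then have "GS.eval ?w3 \<in> vsec (vsec H ?y) [X0]" using c(1) by (rule GS.vsec_eval)
    then have 1: "GS.eval ?w3 \<in> vsec H (?y @ [X0])" by (simp only: vsec_append[OF H])
    show ?thesis
    proof (rule that[OF 1])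
      show "\<not> 3 dvd gs_tau ?w3" using p(1) c(2) by (simp add: case_prod_unfold)
      show "3 dvd gs_eps ?w3" by (rule c(4))
      show "GS.weight ?w3 \<le> GS.weight w'" if "GS.eval w' \<in> vsec H y'" "\<not> 3 dvd gs_tau w'" for y' w'
        using p(2)[of "(y', w')"] that c(3) by simp
    qed
  qed
  obtain x where x: "\<not> 3 dvd gs_tau (GS.sec w x)"
    using yw(2) gs_tau_sec[of w X0] by (metis dvd_add)
  have "GS.eval (GS.sec w x) \<in> vsec (vsec H y) [x]"
    using yw(1,3) by (intro GS.vsec_eval) (simp_all add: gs_act_fixed)
  \<comment> \<open>This section competes in the minimum, so it carries the whole weight, and
    \<open>w\<close> is a power of a conjugate of \<open>t\<close> by a power of
    \<open>a\<close>.\<close>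
  then have "GS.weight w \<le> GS.weight (GS.sec w x)"
    using least[of "GS.sec w x" "y @ [x]"] x by (simp add: vsec_append[OF H])
  then have "GS.weight (GS.sec w (tri_succ x)) = 0" "GS.weight (GS.sec w (tri_pred x)) = 0"
    using gs_weight_sec[of w x] by linarith+
  then obtain n where n: "GS.eval w = gs_a ^^ gs_eps w \<circ> GS.eval (gs_conj_word x) ^^ n" "3 dvd (int n - gs_tau w)"
    using gs_concentrated by blast
  define C where "C = GS.eval (gs_conj_word x)"
  let ?K = "vsec H y"
  have C3: "C \<circ> C \<circ> C = id" unfolding C_def by (rule gs_conj_word_sections(4))
  have "gs_a ^^ gs_eps w = id" unfolding gs_a_power[of "gs_eps w"] using yw(3) by (simp add: dvd_eq_mod_eq_0)
  then have Cn: "C ^^ n \<in> ?K" using yw(1) n(1) by (simp add: C_def)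
  have Cmod: "C ^^ m = C ^^ (m mod 3)" for m
    using fun_cong[OF C3] by (intro funpow_mod_3) simp
  have "n mod 3 \<noteq> 0"
  proof
    assume "n mod 3 = 0"
    then have "3 dvd int n" by presburger
    then show False using n(2) yw(2) by (metis dvd_diff_right_iff)
  qed
  then consider "n mod 3 = 1" | "n mod 3 = 2" by linarith
  then have C: "C \<in> ?K"
  proof cases
    case 1 then show ?thesis using Cn Cmod[of n] by simp
  next
    case 2
    \<comment> \<open>As \<open>C\<close> has cube \<open>id\<close>, the square of
      \<open>C ^^ 2\<close> is \<open>C\<close> again.\<close>
    then have "C ^^ 2 \<in> ?K" using Cn Cmod[of n] by simp
    then have "C ^^ 2 \<circ> C ^^ 2 \<in> ?K" by (intro taut_group_comp[OF VG])
    then have "C ^^ 4 \<in> ?K" using funpow_add[of 2 2 C] by simp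
    then show ?thesis using Cmod[of 4] by simp
  qed
  have t: "gs_t \<in> vsec ?K [x]" and a: "gs_a \<in> vsec ?K [tri_succ x]"
    using GS.vsec_eval[OF C[unfolded C_def] gs_conj_word_sections(1)]
    by (simp_all only: gs_conj_word_sections(2,3)[symmetric, of x])
  \<comment> \<open>\<open>t\<close> and \<open>a\<close> occur as sections at neighbouring letters;
    \<open>k\<close> moves the first letter to the second, at the price of conjugating
    \<open>t\<close>.\<close>
  obtain k where k: "k \<in> ?K" "k [x] = [tri_succ x]"
    using level_transitiveD[OF level_transitive_vsec[OF H trans, of y], of "[x]" "[tri_succ x]"] by auto
  then obtain u where u: "sect k [x] = GS.eval u"
    using GS.sect_G GS.vsec_subset_G[OF HG, of y] by blast
  let ?L = "vsec ?K [tri_succ x]"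
  have L: "taut_group ?L" by (rule taut_group_vsec[OF VG])
  have "GS.eval u \<circ> gs_t \<circ> inv (GS.eval u) \<in> ?L"
    using vsec_orbit[OF VG k(1), of "[x]"] conj_byI[OF t, of "GS.eval u"] by (simp add: k(2) u)
  then have "GS.has_full_section ?L"
    using gs_full_if_conjugate[OF L _ a] GS.vsec_subset_G[OF GS.vsec_subset_G[OF HG]] by blast
  then have "GS.has_full_section H"
    using GS.has_full_section_vsec[OF VG] GS.has_full_section_vsec[OF H] by blast
  then show ?thesis unfolding GS.has_full_section_def .
qed

lemma gs_weight_0: "GS.weight w = 0 \<Longrightarrow> GS.eval w = gs_a ^^ gs_eps w"
proof (induction w)
  case (Cons l w) then show ?case by (cases l) simp_all
qed simp

theorem GN_alternative_gupta_sidki: "GN_alternative gupta_sidki_group"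
proof -
  have "GN_group gs_ev gs_act gs_sec gs_wt"
  proof
    have "GS.eval ` {w. GS.weight w = 0} \<subseteq> (\<lambda>m. gs_a ^^ m) ` {0, 1, 2}"
    proof
      fix f assume "f \<in> GS.eval ` {w. GS.weight w = 0}"
      then obtain w where "f = gs_a ^^ gs_eps w" using gs_weight_0 by blast
      then have "f = gs_a ^^ (gs_eps w mod 3)" using gs_a_power by blast
      moreover have "gs_eps w mod 3 \<in> {0, 1, 2}" by auto
      ultimately show "f \<in> (\<lambda>m. gs_a ^^ m) ` {0, 1, 2}" by (rule image_eqI)
    qed
    then show "finite (GS.eval ` {w. GS.weight w = 0})" by (rule finite_subset) simp
  next
    fix w assume "GS.weight w = 0"
    then have "GS.weight (gs_inv_word w) = 0" by (simp only: gs_weight_inv_word)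
    then show "\<exists>w'. GS.weight w' = 0 \<and> inv (GS.eval w) = GS.eval w'" using gs_eval_inv_word[of w]
      by (intro exI[of _ "gs_inv_word w"]) (simp only: simp_thms)
  next
    fix g x assume g: "g \<in> GS.G"
    \<comment> \<open>The conjugate of \<open>t\<close> belonging to the letter before
      \<open>y\<close> has section \<open>a\<close> at \<open>y\<close>, the one belonging to
      \<open>y\<close> has section \<open>t\<close>.\<close>
    have a: "gs_a \<in> vsec GS.G [y]" and t: "gs_t \<in> vsec GS.G [y]" for y
      using GS.vsec_eval[OF rangeI[of GS.eval] gs_conj_word_sections(1), of "tri_pred y" y]
        GS.vsec_eval[OF rangeI[of GS.eval] gs_conj_word_sections(1), of y y]
        gs_conj_word_sections(2)[of y] gs_conj_word_sections(3)[of "tri_pred y"]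
      by (simp_all only: tri_succ_pred)
    show "g \<in> vsec GS.G [x]" using gs_G_least[OF a t taut_group_vsec[OF GS.taut_group_G]] g by blast
  next
    fix H assume "taut_group H" "H \<subseteq> GS.G" "level_transitive H"
    then show "\<exists>y. vsec H y = GS.G" by (rule gs_level_transitive_full)
  qed
  from GN_group.GN_alternative_G[OF this] show ?thesis by (simp only: gupta_sidki_group_eq)
qed

theorem theorem6p2:
  shows "GN_alternative grigorchuk_group \<and> GN_alternative gupta_sidki_group"
  using GN_alternative_grigorchuk GN_alternative_gupta_sidki by blast

end
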